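(* If a noetherian abelian category $\mathcal{A}$ has a slope-like function $\mu$ (given by group homomorphisms $C_0,C_1$), then every object $E$ of $\mathcal{A}$ has a unique Harder-Narasimhan filtration of the form \[ E_{01}\subseteq E_0\subseteq E_1\subseteq E_2\subseteq\cdots\subseteq E_m=E \] for some positive integer $m$, where - $E_{01}\in\mathcal{B}_{01}$; - $E_0/E_{01}\in\mathcal{B}_0\cap(\mathcal{B}_{01})^\circ$; - for $i\geq 1$, each $E_i/E_{i-1}$ lies in $(\mathcal{B}_0)^\circ$, is $\mu$-semistable, and \[ \mu(E_1/E_0)>\mu(E_2/E_1)>\cdots>\mu(E_m/E_{m-1}). \] (Here, when $E\notin\mathcal{B}_0$, the quotients $E_i/E_{i-1}$, $i\ge1$, are understood to be nonzero.)
   Context: A slope-like function on a noetherian abelian category $\mathcal{A}$ consists of a pair of group homomorphisms $C_0:K(\mathcal{A})\to\mathbb{Z}$ and $C_1:K(\mathcal{A})\to\mathbb{R}$ ($K(\mathcal{A})$ the Grothendieck group) such that $C_0(E)\geq 0$ for every $E\in\mathcal{A}$, and $C_1(E)\geq 0$ whenever $E\in\mathcal{A}$ has $C_0(E)=0$; the function is $\mu(E)=C_1(E)/C_0(E)$ if $C_0(E)\neq 0$ and $\mu(E)=+\infty$ if $C_0(E)=0$. An object $E\in\mathcal{A}$ is $\mu$-semistable if $\mu(F)\leq\mu(E)$ for every $0\neq F\subsetneq E$ in $\mathcal{A}$. Put $\mathcal{B}_0=\{E\in\mathcal{A}:C_0(E)=0\}$ and $\mathcal{B}_{01}=\{E\in\mathcal{A}:C_0(E)=0=C_1(E)\}$.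 For a subcategory $\mathcal{C}\subseteq\mathcal{A}$, $\mathcal{C}^\circ=\{E\in\mathcal{A}:\mathrm{Hom}_{\mathcal{A}}(C,E)=0\text{ for all }C\in\mathcal{C}\}$. *)

theory Defs
  imports Complex_Main "HOL-Library.Extended_Real" "HOL-Algebra.Free_Abelian_Groups"
begin

section \<open>Abelian categories\<close>

text \<open>
  Categories are given by a carrier of objects and a carrier of arrows. Composition and addition of
  arrows are total functions, constrained only on composable and on parallel arrows respectively;
  \<open>g \<cdot> f\<close> means \<open>g\<close> after \<open>f\<close>.
\<close>

record ('o, 'm) add_cat =
  Obj :: "'o set"
  Arr :: "'m set"
  Dom :: "'m \<Rightarrow> 'o"
  Cod :: "'m \<Rightarrow> 'o"
  Ident :: "'o \<Rightarrow> 'm"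
  Comp :: "'m \<Rightarrow> 'm \<Rightarrow> 'm"  (infixl "\<cdot>\<index>" 70)
  AddArr :: "'m \<Rightarrow> 'm \<Rightarrow> 'm"
  ZeroArr :: "'o \<Rightarrow> 'o \<Rightarrow> 'm"

definition Hom :: "('o, 'm, 'x) add_cat_scheme \<Rightarrow> 'o \<Rightarrow> 'o \<Rightarrow> 'm set" where
  "Hom C X Y = {f \<in> Arr C. Dom C f = X \<and> Cod C f = Y}"

definition hom_group :: "('o, 'm, 'x) add_cat_scheme \<Rightarrow> 'o \<Rightarrow> 'o \<Rightarrow> 'm monoid" where
  "hom_group C X Y = \<lparr>carrier = Hom C X Y, monoid.mult = AddArr C, one = ZeroArr C X Y\<rparr>"

locale category =
  fixes C :: "('o, 'm, 'x) add_cat_scheme" (structure)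
  assumes Dom_closed: "f \<in> Arr C \<Longrightarrow> Dom C f \<in> Obj C"
    and Cod_closed: "f \<in> Arr C \<Longrightarrow> Cod C f \<in> Obj C"
    and Ident_in_Hom: "X \<in> Obj C \<Longrightarrow> Ident C X \<in> Hom C X X"
    and Comp_in_Hom: "\<lbrakk>f \<in> Hom C X Y; g \<in> Hom C Y Z\<rbrakk> \<Longrightarrow> g \<cdot> f \<in> Hom C X Z"
    and Comp_assoc: "\<lbrakk>f \<in> Hom C X Y; g \<in> Hom C Y Z; h \<in> Hom C Z W\<rbrakk>
                      \<Longrightarrow> (h \<cdot> g) \<cdot> f = h \<cdot> (g \<cdot> f)"
    and Ident_left: "f \<in> Hom C X Y \<Longrightarrow> Ident C Y \<cdot> f = f"
    and Ident_right: "f \<in> Hom C X Y \<Longrightarrow> f \<cdot> Ident C X = f"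

locale preadditive_category = category +
  assumes hom_comm_group: "\<lbrakk>X \<in> Obj C; Y \<in> Obj C\<rbrakk> \<Longrightarrow> comm_group (hom_group C X Y)"
    and Comp_Add_left: "\<lbrakk>f \<in> Hom C X Y; g \<in> Hom C Y Z; h \<in> Hom C Y Z\<rbrakk>
                        \<Longrightarrow> AddArr C g h \<cdot> f = AddArr C (g \<cdot> f) (h \<cdot> f)"
    and Comp_Add_right: "\<lbrakk>f \<in> Hom C X Y; g \<in> Hom C X Y; h \<in> Hom C Y Z\<rbrakk>
                        \<Longrightarrow> h \<cdot> AddArr C f g = AddArr C (h \<cdot> f) (h \<cdot> g)"

definition zero_object :: "('o, 'm, 'x) add_cat_scheme \<Rightarrow> 'o \<Rightarrow> bool" where
  "zero_object C Z \<longleftrightarrow> Z \<in> Obj C \<and>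
     (\<forall>X \<in> Obj C. (\<exists>!f. f \<in> Hom C X Z) \<and> (\<exists>!f. f \<in> Hom C Z X))"

definition mono_arr :: "('o, 'm, 'x) add_cat_scheme \<Rightarrow> 'm \<Rightarrow> bool" where
  "mono_arr C f \<longleftrightarrow> f \<in> Arr C \<and>
     (\<forall>X. \<forall>g \<in> Hom C X (Dom C f). \<forall>h \<in> Hom C X (Dom C f).
        f \<cdot>\<^bsub>C\<^esub> g = f \<cdot>\<^bsub>C\<^esub> h \<longrightarrow> g = h)"

definition epi_arr :: "('o, 'm, 'x) add_cat_scheme \<Rightarrow> 'm \<Rightarrow> bool" where
  "epi_arr C f \<longleftrightarrow> f \<in> Arr C \<and>
     (\<forall>X. \<forall>g \<in> Hom C (Cod C f) X. \<forall>h \<in> Hom C (Cod C f) X.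
        g \<cdot>\<^bsub>C\<^esub> f = h \<cdot>\<^bsub>C\<^esub> f \<longrightarrow> g = h)"

definition is_kernel :: "('o, 'm, 'x) add_cat_scheme \<Rightarrow> 'm \<Rightarrow> 'm \<Rightarrow> bool" where
  "is_kernel C k f \<longleftrightarrow> f \<in> Arr C \<and> k \<in> Arr C \<and> Cod C k = Dom C f \<and>
     f \<cdot>\<^bsub>C\<^esub> k = ZeroArr C (Dom C k) (Cod C f) \<and>
     (\<forall>X. \<forall>g \<in> Hom C X (Dom C f). f \<cdot>\<^bsub>C\<^esub> g = ZeroArr C X (Cod C f) \<longrightarrow>
        (\<exists>!u. u \<in> Hom C X (Dom C k) \<and> k \<cdot>\<^bsub>C\<^esub> u = g))"

definition is_cokernel :: "('o, 'm, 'x) add_cat_scheme \<Rightarrow> 'm \<Rightarrow> 'm \<Rightarrow> bool" where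
  "is_cokernel C q f \<longleftrightarrow> f \<in> Arr C \<and> q \<in> Arr C \<and> Dom C q = Cod C f \<and>
     q \<cdot>\<^bsub>C\<^esub> f = ZeroArr C (Dom C f) (Cod C q) \<and>
     (\<forall>X. \<forall>g \<in> Hom C (Cod C f) X. g \<cdot>\<^bsub>C\<^esub> f = ZeroArr C (Dom C f) X \<longrightarrow>
        (\<exists>!u. u \<in> Hom C (Cod C q) X \<and> u \<cdot>\<^bsub>C\<^esub> q = g))"

definition is_biproduct ::
  "('o, 'm, 'x) add_cat_scheme \<Rightarrow> 'o \<Rightarrow> 'o \<Rightarrow> 'o \<Rightarrow> 'm \<Rightarrow> 'm \<Rightarrow> 'm \<Rightarrow> 'm \<Rightarrow> bool" where
  "is_biproduct C X Y P i1 i2 p1 p2 \<longleftrightarrow> P \<in> Obj C \<and>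
     i1 \<in> Hom C X P \<and> i2 \<in> Hom C Y P \<and> p1 \<in> Hom C P X \<and> p2 \<in> Hom C P Y \<and>
     p1 \<cdot>\<^bsub>C\<^esub> i1 = Ident C X \<and> p2 \<cdot>\<^bsub>C\<^esub> i2 = Ident C Y \<and>
     p1 \<cdot>\<^bsub>C\<^esub> i2 = ZeroArr C Y X \<and> p2 \<cdot>\<^bsub>C\<^esub> i1 = ZeroArr C X Y \<and>
     AddArr C (i1 \<cdot>\<^bsub>C\<^esub> p1) (i2 \<cdot>\<^bsub>C\<^esub> p2) = Ident C P"

locale abelian_category = preadditive_category +
  assumes zero_object_exists: "\<exists>Z. zero_object C Z"
    and biproduct_exists: "\<lbrakk>X \<in> Obj C; Y \<in> Obj C\<rbrakk> \<Longrightarrow>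
                            \<exists>P i1 i2 p1 p2. is_biproduct C X Y P i1 i2 p1 p2"
    and kernel_exists: "f \<in> Arr C \<Longrightarrow> \<exists>k. is_kernel C k f"
    and cokernel_exists: "f \<in> Arr C \<Longrightarrow> \<exists>q. is_cokernel C q f"
    and mono_is_kernel: "mono_arr C f \<Longrightarrow> \<exists>g. is_kernel C f g"
    and epi_is_cokernel: "epi_arr C f \<Longrightarrow> \<exists>g. is_cokernel C f g"


section \<open>Subobjects and quotients\<close>

definition factors_through :: "('o, 'm, 'x) add_cat_scheme \<Rightarrow> 'm \<Rightarrow> 'm \<Rightarrow> bool" where
  "factors_through C s t \<longleftrightarrow> (\<exists>u \<in> Hom C (Dom C s) (Dom C t). t \<cdot>\<^bsub>C\<^esub> u = s)"

text \<open>Subobjects are equivalence classes of monomorphisms, so that equality of subobjects of \<open>E\<close> is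
  equality in HOL.\<close>

definition subobj_class :: "('o, 'm, 'x) add_cat_scheme \<Rightarrow> 'm \<Rightarrow> 'm set" where
  "subobj_class C s = {t. mono_arr C t \<and> Cod C t = Cod C s \<and>
     factors_through C s t \<and> factors_through C t s}"

definition Sub :: "('o, 'm, 'x) add_cat_scheme \<Rightarrow> 'o \<Rightarrow> 'm set set" where
  "Sub C E = {subobj_class C s | s. mono_arr C s \<and> Cod C s = E}"

definition sub_le :: "('o, 'm, 'x) add_cat_scheme \<Rightarrow> 'm set \<Rightarrow> 'm set \<Rightarrow> bool" where
  "sub_le C S T \<longleftrightarrow> (\<exists>s \<in> S. \<exists>t \<in> T. factors_through C s t)"

definition whole_sub :: "('o, 'm, 'x) add_cat_scheme \<Rightarrow> 'o \<Rightarrow> 'm set" where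
  "whole_sub C E = subobj_class C (Ident C E)"

text \<open>The objects underlying a subobject \<open>S\<close> and a quotient \<open>T/S\<close> are determined up to isomorphism;
  we choose one.\<close>

definition sub_obj :: "('o, 'm, 'x) add_cat_scheme \<Rightarrow> 'm set \<Rightarrow> 'o" where
  "sub_obj C S = Dom C (SOME s. s \<in> S)"

definition is_quot_obj :: "('o, 'm, 'x) add_cat_scheme \<Rightarrow> 'm set \<Rightarrow> 'm set \<Rightarrow> 'o \<Rightarrow> bool" where
  "is_quot_obj C T S Q \<longleftrightarrow>
     (\<exists>s \<in> S. \<exists>t \<in> T. \<exists>u \<in> Hom C (Dom C s) (Dom C t). t \<cdot>\<^bsub>C\<^esub> u = s \<and>
        (\<exists>q. is_cokernel C q u \<and> Cod C q = Q))"

definition quot_obj :: "('o, 'm, 'x) add_cat_scheme \<Rightarrow> 'm set \<Rightarrow> 'm set \<Rightarrow> 'o" where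
  "quot_obj C T S = (SOME Q. is_quot_obj C T S Q)"

locale noetherian_abelian_category = abelian_category +
  assumes ascending_chain_condition:
    "\<lbrakk>E \<in> Obj C; \<And>n::nat. S n \<in> Sub C E; \<And>n. sub_le C (S n) (S (Suc n))\<rbrakk>
      \<Longrightarrow> \<exists>N. \<forall>n \<ge> N. S n = S N"


section \<open>The Grothendieck group\<close>

definition short_exact :: "('o, 'm, 'x) add_cat_scheme \<Rightarrow> 'm \<Rightarrow> 'm \<Rightarrow> bool" where
  "short_exact C f g \<longleftrightarrow> is_kernel C f g \<and> is_cokernel C g f"

definition K_relations :: "('o, 'm, 'x) add_cat_scheme \<Rightarrow> ('o \<Rightarrow>\<^sub>0 int) set" where
  "K_relations C = {frag_of (Cod C f) - frag_of (Dom C f) - frag_of (Cod C g) | f g.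
     short_exact C f g}"

definition K_subgroup :: "('o, 'm, 'x) add_cat_scheme \<Rightarrow> ('o \<Rightarrow>\<^sub>0 int) set" where
  "K_subgroup C = generate (free_Abelian_group (Obj C)) (K_relations C)"

definition K_group :: "('o, 'm, 'x) add_cat_scheme \<Rightarrow> ('o \<Rightarrow>\<^sub>0 int) set monoid" where
  "K_group C = free_Abelian_group (Obj C) Mod K_subgroup C"

definition K_class :: "('o, 'm, 'x) add_cat_scheme \<Rightarrow> 'o \<Rightarrow> ('o \<Rightarrow>\<^sub>0 int) set" where
  "K_class C E = K_subgroup C #>\<^bsub>free_Abelian_group (Obj C)\<^esub> frag_of E"

definition real_group :: "real monoid" where
  "real_group = \<lparr>carrier = UNIV, monoid.mult = (+), one = 0\<rparr>"


section \<open>Slope-like functions and Harder-Narasimhan filtrations\<close>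

locale slope_like =
  fixes C :: "('o, 'm, 'x) add_cat_scheme"
    and C0 :: "('o \<Rightarrow>\<^sub>0 int) set \<Rightarrow> int"
    and C1 :: "('o \<Rightarrow>\<^sub>0 int) set \<Rightarrow> real"
  assumes C0_hom: "C0 \<in> hom (K_group C) integer_group"
    and C1_hom: "C1 \<in> hom (K_group C) real_group"
    and C0_nonneg: "E \<in> Obj C \<Longrightarrow> C0 (K_class C E) \<ge> 0"
    and C1_nonneg: "\<lbrakk>E \<in> Obj C; C0 (K_class C E) = 0\<rbrakk> \<Longrightarrow> C1 (K_class C E) \<ge> 0"

definition slope :: "('o, 'm, 'x) add_cat_scheme \<Rightarrow> (('o \<Rightarrow>\<^sub>0 int) set \<Rightarrow> int) \<Rightarrow>
    (('o \<Rightarrow>\<^sub>0 int) set \<Rightarrow> real) \<Rightarrow> 'o \<Rightarrow> ereal" where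
  "slope C C0 C1 E = (if C0 (K_class C E) \<noteq> 0
     then ereal (C1 (K_class C E) / of_int (C0 (K_class C E))) else \<infinity>)"

definition semistable :: "('o, 'm, 'x) add_cat_scheme \<Rightarrow> (('o \<Rightarrow>\<^sub>0 int) set \<Rightarrow> int) \<Rightarrow>
    (('o \<Rightarrow>\<^sub>0 int) set \<Rightarrow> real) \<Rightarrow> 'o \<Rightarrow> bool" where
  "semistable C C0 C1 E \<longleftrightarrow> E \<in> Obj C \<and>
     (\<forall>F \<in> Sub C E. \<not> zero_object C (sub_obj C F) \<and> F \<noteq> whole_sub C E \<longrightarrow>
        slope C C0 C1 (sub_obj C F) \<le> slope C C0 C1 E)"

text \<open>Full subcategories are given by their sets of objects.\<close>

definition B0 :: "('o, 'm, 'x) add_cat_scheme \<Rightarrow> (('o \<Rightarrow>\<^sub>0 int) set \<Rightarrow> int) \<Rightarrow> 'o set" where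
  "B0 C C0 = {E \<in> Obj C. C0 (K_class C E) = 0}"

definition B01 :: "('o, 'm, 'x) add_cat_scheme \<Rightarrow> (('o \<Rightarrow>\<^sub>0 int) set \<Rightarrow> int) \<Rightarrow>
    (('o \<Rightarrow>\<^sub>0 int) set \<Rightarrow> real) \<Rightarrow> 'o set" where
  "B01 C C0 C1 = {E \<in> Obj C. C0 (K_class C E) = 0 \<and> C1 (K_class C E) = 0}"

definition right_orth :: "('o, 'm, 'x) add_cat_scheme \<Rightarrow> 'o set \<Rightarrow> 'o set" where
  "right_orth C \<C> = {E \<in> Obj C. \<forall>X \<in> \<C>. Hom C X E = {ZeroArr C X E}}"

text \<open>
  \<open>Es\<close> is the list \<open>[E\<^sub>0, \<dots>, E\<^sub>m]\<close> of subobjects of \<open>E\<close>, so \<open>m\<close> is determined by \<open>Es\<close>.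
  For \<open>E \<in> B\<^sub>0\<close> the only possibility is \<open>m = 1\<close> and \<open>E\<^sub>0 = E\<^sub>1 = E\<close>.
\<close>

definition HN_filtration :: "('o, 'm, 'x) add_cat_scheme \<Rightarrow> (('o \<Rightarrow>\<^sub>0 int) set \<Rightarrow> int) \<Rightarrow>
    (('o \<Rightarrow>\<^sub>0 int) set \<Rightarrow> real) \<Rightarrow> 'o \<Rightarrow> 'm set \<times> 'm set list \<Rightarrow> bool" where
  "HN_filtration C C0 C1 E = (\<lambda>(E01, Es). \<exists>m \<ge> 1. length Es = Suc m \<and>
     E01 \<in> Sub C E \<and> set Es \<subseteq> Sub C E \<and>
     sub_le C E01 (Es ! 0) \<and> (\<forall>i \<in> {1..m}. sub_le C (Es ! (i - 1)) (Es ! i)) \<and>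
     Es ! m = whole_sub C E \<and>
     sub_obj C E01 \<in> B01 C C0 C1 \<and>
     quot_obj C (Es ! 0) E01 \<in> B0 C C0 \<inter> right_orth C (B01 C C0 C1) \<and>
     (\<forall>i \<in> {1..m}. quot_obj C (Es ! i) (Es ! (i - 1)) \<in> right_orth C (B0 C C0) \<and>
        semistable C C0 C1 (quot_obj C (Es ! i) (Es ! (i - 1)))) \<and>
     (\<forall>i \<in> {1..<m}. slope C C0 C1 (quot_obj C (Es ! i) (Es ! (i - 1))) >
        slope C C0 C1 (quot_obj C (Es ! Suc i) (Es ! i))) \<and>
     (E \<notin> B0 C C0 \<longrightarrow> (\<forall>i \<in> {1..m}. \<not> zero_object C (quot_obj C (Es ! i) (Es ! (i - 1))))))"

end

theory Submission
  imports Defs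
begin

text \<open>
  The whole statement lives on the partially ordered set of subobjects of \<open>E\<close>. It has joins and meets;
  \<open>C\<^sub>0\<close> (rank) and \<open>C\<^sub>1\<close> (degree) are modular on it; the rank is monotone, the degree is monotone between
  subobjects of equal rank, and ascending chains become stationary. Subobjects of a quotient \<open>T/S\<close>
  correspond to subobjects between \<open>S\<close> and \<open>T\<close>, with classes shifted by that of \<open>S\<close>. So semistability
  and orthogonality of \<open>T/S\<close> become statements about the interval from \<open>S\<close> to \<open>T\<close>, and
  \<open>HN_filtration_iff\<close> reduces the theorem to a statement about lattices with a rank and a degree,
  \<open>HN_chain_ex1\<close>.

  For the latter, fix a real number \<open>l\<close> and consider the modular function \<open>disc l = degree - l * rank\<close>.
  It has a maximum, and among its maximisers there is a greatest one, the canonical element at \<open>l\<close>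
  (\<open>canonical_exists\<close>). This is where the chain condition enters; the descending induction that
  Harder-Narasimhan theory otherwise takes from an artinian hypothesis is an induction on the rank, a
  nonnegative integer. As \<open>l\<close> decreases, the canonical elements increase
  (\<open>canonical_antimono\<close>), and the rank separates them, so there are finitely many. They are the
  members of the Harder-Narasimhan filtration:

  \<^item> Between consecutive canonical elements \<open>S\<close> and \<open>T\<close>, with slope \<open>mu\<close>, both \<open>S\<close> and \<open>T\<close> maximise
    \<open>disc mu\<close> (\<open>canonical_slope\<close>), so the interval is semistable. The slopes decrease since the canonical
    elements increase.

  \<^item> Conversely, in any Harder-Narasimhan filtration of an object of positive rank the term \<open>E\<^sub>i\<close> is
    canonical at every \<open>l\<close> between the slopes of the steps after and before it
    (\<open>HN_chain_members\<close>), which gives uniqueness.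

  For an object of rank zero all slopes are infinite and the only possibility is \<open>E\<^sub>0 = E\<^sub>1 = E\<close>. In all
  cases \<open>E\<^sub>0\<^sub>1\<close> is the largest subobject of \<open>E\<^sub>0\<close> of rank and degree zero (\<open>null_part_ex1\<close>).
\<close>

section \<open>Harder-Narasimhan chains in a lattice with rank and degree\<close>

text \<open>
  What the subobjects of an object inherit from \<open>C\<^sub>0\<close> (here \<open>c0\<close>, the rank) and \<open>C\<^sub>1\<close> (here \<open>c1\<close>, the
  degree). Modularity comes from \<open>(S + T)/T \<cong> S/(S \<inter> T)\<close>; \<open>c0_mono\<close> says that a quotient \<open>T/S\<close> has
  nonnegative rank, and \<open>c1_mono\<close> that its degree is nonnegative if its rank vanishes.
\<close>

locale slope_lattice =
  fixes L :: "'a set"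
    and le :: "'a \<Rightarrow> 'a \<Rightarrow> bool"  (infix "\<preceq>" 50)
    and join :: "'a \<Rightarrow> 'a \<Rightarrow> 'a"  (infixl "\<curlyvee>" 65)
    and meet :: "'a \<Rightarrow> 'a \<Rightarrow> 'a"  (infixl "\<curlywedge>" 70)
    and least :: 'a
    and greatest :: 'a
    and c0 :: "'a \<Rightarrow> int"
    and c1 :: "'a \<Rightarrow> real"
  assumes le_refl: "S \<in> L \<Longrightarrow> S \<preceq> S"
    and le_trans: "\<lbrakk>R \<in> L; S \<in> L; T \<in> L; R \<preceq> S; S \<preceq> T\<rbrakk> \<Longrightarrow> R \<preceq> T"
    and le_antisym: "\<lbrakk>S \<in> L; T \<in> L; S \<preceq> T; T \<preceq> S\<rbrakk> \<Longrightarrow> S = T"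
    and least_in: "least \<in> L"
    and least_le: "S \<in> L \<Longrightarrow> least \<preceq> S"
    and greatest_in: "greatest \<in> L"
    and le_greatest: "S \<in> L \<Longrightarrow> S \<preceq> greatest"
    and join_in: "\<lbrakk>S \<in> L; T \<in> L\<rbrakk> \<Longrightarrow> S \<curlyvee> T \<in> L"
    and join_left: "\<lbrakk>S \<in> L; T \<in> L\<rbrakk> \<Longrightarrow> S \<preceq> S \<curlyvee> T"
    and join_right: "\<lbrakk>S \<in> L; T \<in> L\<rbrakk> \<Longrightarrow> T \<preceq> S \<curlyvee> T"
    and join_least: "\<lbrakk>S \<in> L; T \<in> L; W \<in> L; S \<preceq> W; T \<preceq> W\<rbrakk> \<Longrightarrow> S \<curlyvee> T \<preceq> W"
    and meet_in: "\<lbrakk>S \<in> L; T \<in> L\<rbrakk> \<Longrightarrow> S \<curlywedge> T \<in> L"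
    and meet_left: "\<lbrakk>S \<in> L; T \<in> L\<rbrakk> \<Longrightarrow> S \<curlywedge> T \<preceq> S"
    and meet_right: "\<lbrakk>S \<in> L; T \<in> L\<rbrakk> \<Longrightarrow> S \<curlywedge> T \<preceq> T"
    and meet_greatest: "\<lbrakk>S \<in> L; T \<in> L; W \<in> L; W \<preceq> S; W \<preceq> T\<rbrakk> \<Longrightarrow> W \<preceq> S \<curlywedge> T"
    and c0_modular: "\<lbrakk>S \<in> L; T \<in> L\<rbrakk> \<Longrightarrow> c0 (S \<curlyvee> T) + c0 (S \<curlywedge> T) = c0 S + c0 T"
    and c1_modular: "\<lbrakk>S \<in> L; T \<in> L\<rbrakk> \<Longrightarrow> c1 (S \<curlyvee> T) + c1 (S \<curlywedge> T) = c1 S + c1 T"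
    and c0_least: "c0 least = 0"
    and c1_least: "c1 least = 0"
    and c0_mono: "\<lbrakk>S \<in> L; T \<in> L; S \<preceq> T\<rbrakk> \<Longrightarrow> c0 S \<le> c0 T"
    and c1_mono: "\<lbrakk>S \<in> L; T \<in> L; S \<preceq> T; c0 S = c0 T\<rbrakk> \<Longrightarrow> c1 S \<le> c1 T"
    and acc: "\<lbrakk>\<And>n::nat. X n \<in> L; \<And>n. X n \<preceq> X (Suc n)\<rbrakk> \<Longrightarrow> \<exists>N. \<forall>n\<ge>N. X n = X N"
begin

lemma greatest_of_join_closed:
  assumes "P \<subseteq> L" "P \<noteq> {}" and closed: "\<And>S T. \<lbrakk>S \<in> P; T \<in> P\<rbrakk> \<Longrightarrow> S \<curlyvee> T \<in> P"
  shows "\<exists>G\<in>P. \<forall>S\<in>P. S \<preceq> G"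
proof (rule ccontr)
  assume "\<not> ?thesis"
  then have "\<forall>G\<in>P. \<exists>S\<in>P. \<not> S \<preceq> G" by blast
  then obtain f where f: "\<And>G. G \<in> P \<Longrightarrow> f G \<in> P \<and> \<not> f G \<preceq> G" by metis
  obtain p where p: "p \<in> P" using assms(2) by blast
  define X where "X = rec_nat p (\<lambda>_ G. G \<curlyvee> f G)"
  have X0: "X 0 = p" and XS: "\<And>n. X (Suc n) = X n \<curlyvee> f (X n)" by (simp_all add: X_def)
  have XP: "X n \<in> P" for n by (induction n) (use p f closed XS X0 in auto)
  then have XL: "X n \<in> L" "f (X n) \<in> L" for n using f assms(1) by blast+
  have "\<exists>N. \<forall>n\<ge>N. X n = X N" by (rule acc) (use XL XS join_left in auto)
  then obtain N where "X (Suc N) = X N" by (metis le_Suc_eq order_refl)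
  then have "f (X N) \<preceq> X N" using XS join_right XL by metis
  then show False using f XP by blast
qed

lemma le_join_iff_eq:
  assumes "S \<in> L" "T \<in> L" shows "S \<curlyvee> T = T \<longleftrightarrow> S \<preceq> T"
  using assms by (metis join_in join_least join_left join_right le_antisym le_refl)

lemma c0_nonneg: "S \<in> L \<Longrightarrow> 0 \<le> c0 S"
  using c0_mono[of least S] c0_least least_in least_le by simp

lemma c1_nonneg: "\<lbrakk>S \<in> L; c0 S = 0\<rbrakk> \<Longrightarrow> 0 \<le> c1 S"
  using c1_mono[of least S] c0_least c1_least least_in least_le by simp

text \<open>
  For a real number \<open>l\<close>, \<open>disc l\<close> is the degree after a shift that moves slope \<open>l\<close> to slope 0: a
  quotient \<open>T/S\<close> of positive rank has slope at least \<open>l\<close> iff \<open>disc l S \<le> disc l T\<close>. Like rank and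
  degree it is modular, which slopes are not.
\<close>

definition disc :: "real \<Rightarrow> 'a \<Rightarrow> real" where
  "disc l S = c1 S - l * c0 S"

lemma disc_modular:
  "\<lbrakk>S \<in> L; T \<in> L\<rbrakk> \<Longrightarrow> disc l (S \<curlyvee> T) + disc l (S \<curlywedge> T) = disc l S + disc l T"
  using c0_modular[of S T] c1_modular[of S T] unfolding disc_def
  by (simp add: algebra_simps flip: of_int_add distrib_left)

lemma disc_mono: "\<lbrakk>S \<in> L; T \<in> L; S \<preceq> T; c0 S = c0 T\<rbrakk> \<Longrightarrow> disc l S \<le> disc l T"
  using c1_mono[of S T] by (simp add: disc_def)

lemma disc_change: "disc l S - disc l T = disc k S - disc k T + (k - l) * (c0 S - c0 T)"
  by (simp add: disc_def algebra_simps)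

text \<open>
  The greatest among the maximisers of \<open>disc l\<close>. In terms of slopes it is the largest element all of
  whose quotients have slope at least \<open>l\<close>, the torsion part of a torsion pair.
\<close>

definition canonical :: "real \<Rightarrow> 'a \<Rightarrow> bool" where
  "canonical l S \<longleftrightarrow> S \<in> L \<and> (\<forall>U\<in>L. disc l U \<le> disc l S \<and> (disc l U = disc l S \<longrightarrow> U \<preceq> S))"

lemma canonicalI:
  assumes "S \<in> L" "\<And>U. U \<in> L \<Longrightarrow> disc l U < disc l S \<or> disc l U = disc l S \<and> U \<preceq> S"
  shows "canonical l S"
  unfolding canonical_def using assms by force

lemma canonical_in: "canonical l S \<Longrightarrow> S \<in> L"
  and canonical_max: "\<lbrakk>canonical l S; U \<in> L\<rbrakk> \<Longrightarrow> disc l U \<le> disc l S"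
  and canonical_greatest: "\<lbrakk>canonical l S; U \<in> L; disc l S \<le> disc l U\<rbrakk> \<Longrightarrow> U \<preceq> S"
  unfolding canonical_def by (auto intro: antisym)

lemma canonical_unique: "\<lbrakk>canonical l S; canonical l T\<rbrakk> \<Longrightarrow> S = T"
  by (meson canonical_greatest canonical_in canonical_max le_antisym)

lemma disc_join_ge:
  assumes "S \<in> L" "W \<in> L" and top: "\<And>U. \<lbrakk>U \<in> L; U \<preceq> S\<rbrakk> \<Longrightarrow> disc l U \<le> disc l S"
  shows "disc l W \<le> disc l (W \<curlyvee> S)"
  using disc_modular[of W S l] top[of "W \<curlywedge> S"] meet_in[of W S] meet_right[of W S] assms(1,2)
  by linarith

text \<open>
  The elements \<open>S\<close> that no element below exceeds in \<open>disc l\<close> form a set closed under joins, because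
  adding \<open>S\<close> to any \<open>W\<close> does not lower \<open>disc l\<close>. Hence there is a greatest one, \<open>G\<close>. An element
  strictly above \<open>G\<close> with no smaller discrepancy, of least rank among these, would again lie in that
  set: anything below it can be enlarged by \<open>G\<close>, and then is \<open>G\<close> itself, or has smaller rank, so that
  minimality applies, or has equal rank and therefore no larger degree.
\<close>

lemma canonical_exists: "\<exists>S. canonical l S"
proof -
  define P where "P = {S\<in>L. \<forall>W\<in>L. W \<preceq> S \<longrightarrow> disc l W \<le> disc l S}"
  have PL: "P \<subseteq> L" by (auto simp: P_def)
  have ge: "disc l W \<le> disc l (W \<curlyvee> S)" if "S \<in> P" "W \<in> L" for S W
    using disc_join_ge that by (auto simp: P_def)
  have "least \<in> P" unfolding P_def using least_in least_le le_antisym by fastforce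
  moreover have "S \<curlyvee> T \<in> P" if S: "S \<in> P" and T: "T \<in> P" for S T
  proof -
    have SL: "S \<in> L" and TL: "T \<in> L" using S T PL by auto
    have "disc l W \<le> disc l (S \<curlyvee> T)" if W: "W \<in> L" "W \<preceq> S \<curlyvee> T" for W
    proof -
      have WS: "W \<curlyvee> S \<in> L" using W SL join_in by simp
      have "W \<curlyvee> S \<curlyvee> T \<preceq> S \<curlyvee> T"
        by (intro join_least WS TL join_in SL W join_left join_right)
      moreover have "S \<curlyvee> T \<preceq> W \<curlyvee> S \<curlyvee> T"
        using join_least[OF SL TL, of "W \<curlyvee> S \<curlyvee> T"] WS TL SL W
        by (meson join_in join_left join_right le_trans)
      ultimately have "W \<curlyvee> S \<curlyvee> T = S \<curlyvee> T" using le_antisym WS TL SL join_in by blast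
      then show ?thesis using ge[OF S W(1)] ge[OF T WS] by simp
    qed
    then show ?thesis using join_in[OF SL TL] by (auto simp: P_def)
  qed
  ultimately obtain G where G: "G \<in> P" and Gmax: "\<And>S. S \<in> P \<Longrightarrow> S \<preceq> G"
    using greatest_of_join_closed[OF PL] by blast
  have GL: "G \<in> L" using G PL by blast
  have above: "disc l V < disc l G" if "V \<in> L" "G \<preceq> V" "V \<noteq> G" for V
    using that
  proof (induction "nat (c0 V)" arbitrary: V rule: less_induct)
    case less
    show ?case
    proof (rule ccontr)
      assume neg: "\<not> ?thesis"
      have "disc l W \<le> disc l V" if W: "W \<in> L" "W \<preceq> V" for W
      proof -
        have WG: "W \<curlyvee> G \<in> L" "G \<preceq> W \<curlyvee> G" "W \<curlyvee> G \<preceq> V"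
          using W GL less.prems join_in join_right join_least by auto
        have "disc l (W \<curlyvee> G) \<le> disc l V"
        proof (cases "c0 (W \<curlyvee> G) = c0 V")
          case True
          then show ?thesis using disc_mono WG less.prems by blast
        next
          case False
          then have "nat (c0 (W \<curlyvee> G)) < nat (c0 V)"
            using c0_mono[OF WG(1) less.prems(1) WG(3)] c0_nonneg[OF WG(1)] by linarith
          then show ?thesis using less.hyps[OF _ WG(1,2)] neg by force
        qed
        then show ?thesis using ge[OF G W(1)] by simp
      qed
      then have "V \<in> P" using less.prems by (simp add: P_def)
      then show False using Gmax le_antisym less.prems GL by blast
    qed
  qed
  have "canonical l G"
  proof (rule canonicalI[OF GL])
    fix U assume U: "U \<in> L"
    show "disc l U < disc l G \<or> disc l U = disc l G \<and> U \<preceq> G"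
      using ge[OF G U] above[of "U \<curlyvee> G"] join_in[OF U GL] join_right[OF U GL]
        le_join_iff_eq[OF U GL] by force
  qed
  then show ?thesis by blast
qed

text \<open>
  Lowering the parameter from \<open>k\<close> to \<open>l\<close> adds a nonnegative multiple of the rank, so \<open>S\<close> still has at
  least the discrepancy of \<open>S \<curlywedge> T\<close>. By modularity \<open>S \<curlyvee> T\<close> then has at least that of \<open>T\<close>, and \<open>T\<close> was
  the greatest maximiser.
\<close>

lemma canonical_antimono:
  assumes S: "canonical k S" and T: "canonical l T" and "l \<le> k"
  shows "S \<preceq> T"
proof -
  note [simp] = canonical_in[OF S] canonical_in[OF T]
  define I where "I = S \<curlywedge> T"
  have I: "I \<in> L" "I \<preceq> S" by (simp_all add: I_def meet_in meet_left)
  have "0 \<le> (k - l) * real_of_int (c0 S - c0 I)"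
    using \<open>l \<le> k\<close> c0_mono[of I S] I by (intro mult_nonneg_nonneg) auto
  then have "disc l I \<le> disc l S"
    using canonical_max[OF S I(1)] disc_change[of l S I k] by simp
  then have "disc l T \<le> disc l (S \<curlyvee> T)"
    using disc_modular[of S T l] by (simp add: I_def)
  then have "S \<curlyvee> T \<preceq> T" using canonical_greatest[OF T] by (simp add: join_in)
  then show ?thesis using join_left[of S T] le_trans[of S "S \<curlyvee> T" T] by (simp add: join_in)
qed

lemma canonical_rank_maximal:
  assumes "canonical l S" "U \<in> L" "S \<preceq> U" "c0 U = c0 S" shows "U = S"
proof -
  have SL: "S \<in> L" using assms canonical_in by blast
  have "disc l S \<le> disc l U" using disc_mono[OF SL assms(2)] assms by simp
  then show ?thesis using canonical_greatest[OF assms(1,2)] assms le_antisym SL by blast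
qed

text \<open>
  The members of the Harder-Narasimhan chain of the whole lattice. They form a chain on which the rank
  is injective, so there are only finitely many.
\<close>

definition canonicals :: "'a set" where
  "canonicals = {S. \<exists>l. canonical l S}"

lemma canonicals_linear: "\<lbrakk>S \<in> canonicals; T \<in> canonicals\<rbrakk> \<Longrightarrow> S \<preceq> T \<or> T \<preceq> S"
proof -
  assume "S \<in> canonicals" "T \<in> canonicals"
  then obtain k l where "canonical k S" "canonical l T" by (auto simp: canonicals_def)
  then show ?thesis using canonical_antimono[of k S l T] canonical_antimono[of l T k S] by linarith
qed

lemma canonicals_in: "canonicals \<subseteq> L"
  by (auto simp: canonicals_def canonical_in)

lemma inj_on_c0_canonicals: "inj_on c0 canonicals"
proof (rule inj_onI)
  fix S T assume ST: "S \<in> canonicals" "T \<in> canonicals" "c0 S = c0 T"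
  then obtain k l where kl: "canonical k S" "canonical l T" by (auto simp: canonicals_def)
  from canonicals_linear[OF ST(1,2)] show "S = T"
    using canonical_rank_maximal[OF kl(1), of T] canonical_rank_maximal[OF kl(2), of S]
      canonical_in[OF kl(1)] canonical_in[OF kl(2)] ST(3) by auto
qed

lemma finite_c0_canonicals: "finite (c0 ` canonicals)"
proof -
  have "c0 ` canonicals \<subseteq> {0..c0 greatest}"
  proof
    fix r assume "r \<in> c0 ` canonicals"
    then obtain S where "S \<in> L" "r = c0 S" using canonicals_in by blast
    then show "r \<in> {0..c0 greatest}"
      using c0_nonneg[of S] c0_mono[of S greatest] le_greatest[of S] greatest_in by simp
  qed
  then show ?thesis by (rule finite_subset) simp
qed

lemma finite_canonicals: "finite canonicals"
  using finite_c0_canonicals inj_on_c0_canonicals finite_imageD by blast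

lemma canonicals_le_iff:
  assumes "S \<in> canonicals" "T \<in> canonicals"
  shows "S \<preceq> T \<longleftrightarrow> c0 S \<le> c0 T"
proof -
  have L: "S \<in> L" "T \<in> L" using assms canonicals_in by auto
  have "S = T" if "c0 S = c0 T" using inj_onD[OF inj_on_c0_canonicals that] assms by blast
  then show ?thesis
    using canonicals_linear[OF assms] c0_mono[OF L] c0_mono[OF L(2,1)] le_refl[OF L(1)] by force
qed

text \<open>
  If every canonical element had positive rank, then for a parameter above all of their slopes the
  canonical element would have negative discrepancy, which is less than that of the least element.
\<close>

lemma canonical_rank_zero: "\<exists>S\<in>canonicals. c0 S = 0"
proof (rule ccontr)
  assume "\<not> ?thesis"
  then have pos: "0 < c0 S" if "S \<in> canonicals" for S
    using that canonicals_in c0_nonneg by (metis order_le_less subsetD)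
  define b where "b = Max ((\<lambda>S. c1 S / c0 S) ` canonicals) + 1"
  obtain S where S: "canonical b S" using canonical_exists by blast
  then have SM: "S \<in> canonicals" by (auto simp: canonicals_def)
  then have "c1 S / c0 S < b"
    unfolding b_def using finite_canonicals by (meson Max_ge finite_imageI image_eqI less_add_one order_le_less_trans)
  then have "c1 S < b * c0 S" using pos[OF SM] by (simp add: divide_less_eq)
  moreover have "disc b least \<le> disc b S" by (rule canonical_max[OF S least_in])
  ultimately show False by (simp add: disc_def c0_least c1_least)
qed

text \<open>
  For a sufficiently small parameter the discrepancy is dominated by the rank, so the canonical element
  has maximal rank; and nothing strictly above a canonical element has the same rank.
\<close>

lemma greatest_canonical: "greatest \<in> canonicals"
proof -
  define g where "g = (\<lambda>S. (c1 greatest - c1 S) / (c0 greatest - c0 S))"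
  define b where "b = Min (g ` canonicals) - 1"
  obtain S where S: "canonical b S" using canonical_exists by blast
  then have SM: "S \<in> canonicals" by (auto simp: canonicals_def)
  note SL = canonical_in[OF S]
  have "b < g S"
    unfolding b_def using Min_le[OF finite_imageI[OF finite_canonicals] imageI[OF SM], of g] by linarith
  moreover have "disc b greatest \<le> disc b S" by (rule canonical_max[OF S greatest_in])
  ultimately have "\<not> c0 S < c0 greatest"
    unfolding g_def disc_def by (auto simp: field_simps)
  then have "c0 greatest = c0 S" using c0_mono[OF SL greatest_in] le_greatest[OF SL] by simp
  then have "greatest = S" using canonical_rank_maximal[OF S greatest_in] le_greatest[OF SL] by simp
  then show ?thesis using SM by simp
qed

text \<open>
  The notions below render, for the interval from \<open>S\<close> to \<open>T\<close>, properties of a quotient object \<open>T/S\<close>: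
  its slope, its semistability, and the absence of nonzero subobjects of rank zero, or of rank and
  degree zero.
\<close>

definition interval_slope :: "'a \<Rightarrow> 'a \<Rightarrow> ereal" where
  "interval_slope S T = (if c0 T - c0 S \<noteq> 0 then ereal ((c1 T - c1 S) / of_int (c0 T - c0 S)) else \<infinity>)"

definition interval_semistable :: "'a \<Rightarrow> 'a \<Rightarrow> bool" where
  "interval_semistable S T \<longleftrightarrow> (\<forall>U\<in>L. S \<preceq> U \<and> U \<preceq> T \<and> U \<noteq> S \<and> U \<noteq> T \<longrightarrow>
     interval_slope S U \<le> interval_slope S T)"

definition torsion_free :: "'a \<Rightarrow> 'a \<Rightarrow> bool" where
  "torsion_free S T \<longleftrightarrow> (\<forall>U\<in>L. S \<preceq> U \<and> U \<preceq> T \<and> c0 U = c0 S \<longrightarrow> U = S)"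

definition null_free :: "'a \<Rightarrow> 'a \<Rightarrow> bool" where
  "null_free S T \<longleftrightarrow> (\<forall>U\<in>L. S \<preceq> U \<and> U \<preceq> T \<and> c0 U = c0 S \<and> c1 U = c1 S \<longrightarrow> U = S)"

text \<open>
  This is the part of a Harder-Narasimhan filtration that concerns the list \<open>[E\<^sub>0, \<dots>, E\<^sub>m]\<close>.
\<close>

definition HN_chain :: "'a list \<Rightarrow> bool" where
  "HN_chain Es \<longleftrightarrow> (\<exists>m\<ge>1. length Es = Suc m \<and> set Es \<subseteq> L \<and>
     (\<forall>i\<in>{1..m}. Es ! (i - 1) \<preceq> Es ! i) \<and> Es ! m = greatest \<and> c0 (Es ! 0) = 0 \<and>
     (\<forall>i\<in>{1..m}. torsion_free (Es ! (i - 1)) (Es ! i) \<and> interval_semistable (Es ! (i - 1)) (Es ! i)) \<and>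
     (\<forall>i\<in>{1..<m}. interval_slope (Es ! (i - 1)) (Es ! i) > interval_slope (Es ! i) (Es ! Suc i)) \<and>
     (c0 greatest \<noteq> 0 \<longrightarrow> (\<forall>i\<in>{1..m}. Es ! (i - 1) \<noteq> Es ! i)))"

text \<open>
  The slope of an interval of positive rank as a real number, so that it can serve as a parameter of
  \<open>disc\<close>.
\<close>

definition real_slope :: "'a \<Rightarrow> 'a \<Rightarrow> real" where
  "real_slope S T = (c1 T - c1 S) / of_int (c0 T - c0 S)"

lemma disc_le_iff_slope:
  assumes "c0 S < c0 T"
  shows "disc l S \<le> disc l T \<longleftrightarrow> l \<le> real_slope S T" "disc l T \<le> disc l S \<longleftrightarrow> real_slope S T \<le> l"
  using assms by (auto simp: real_slope_def disc_def field_simps)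

lemma interval_slope_real: "c0 S < c0 T \<Longrightarrow> interval_slope S T = ereal (real_slope S T)"
  by (simp add: interval_slope_def real_slope_def)

lemma torsion_free_rank_less:
  assumes "torsion_free S T" "S \<in> L" "U \<in> L" "S \<preceq> U" "U \<preceq> T" "U \<noteq> S"
  shows "c0 S < c0 U"
  using assms c0_mono[of S U] unfolding torsion_free_def by force

text \<open>
  With the slope of the interval as parameter, \<open>disc\<close> takes the same value at both ends, and
  semistability says that no value in between is larger. Moving the parameter adds a multiple of the
  rank, which gives the next two lemmas: for a parameter up to the slope the upper end is a maximum, for
  a larger one the lower end is a strict maximum.
\<close>

lemma semistable_disc_le:
  assumes "S \<in> L" "T \<in> L" "S \<preceq> T" "S \<noteq> T" "torsion_free S T" "interval_semistable S T"
    and U: "U \<in> L" "S \<preceq> U" "U \<preceq> T" and l: "l = real_slope S T"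
  shows "disc l U \<le> disc l S" "disc l S = disc l T"
proof -
  have ST: "c0 S < c0 T" using torsion_free_rank_less[OF assms(5)] assms le_refl by metis
  show eq: "disc l S = disc l T" using disc_le_iff_slope[OF ST, of l] l by auto
  show "disc l U \<le> disc l S"
  proof (cases "U = S \<or> U = T")
    case True then show ?thesis using eq by auto
  next
    case False
    then have SU: "c0 S < c0 U" using torsion_free_rank_less[OF assms(5)] assms by metis
    have "interval_slope S U \<le> interval_slope S T" using assms(6) False U
      unfolding interval_semistable_def by blast
    then have "real_slope S U \<le> real_slope S T" using interval_slope_real SU ST by simp
    then show ?thesis using disc_le_iff_slope(2)[OF SU] l by simp
  qed
qed

lemma semistable_disc_le_top:
  assumes "S \<in> L" "T \<in> L" "S \<preceq> T" "S \<noteq> T" "torsion_free S T" "interval_semistable S T"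
    and U: "U \<in> L" "S \<preceq> U" "U \<preceq> T" and l: "l \<le> real_slope S T"
  shows "disc l U \<le> disc l T"
proof -
  have "0 \<le> (real_slope S T - l) * real_of_int (c0 T - c0 U)"
    using l c0_mono[OF U(1) assms(2) U(3)] by simp
  then show ?thesis
    using semistable_disc_le[OF assms(1-9) refl] disc_change[of l T U "real_slope S T"] by simp
qed

lemma semistable_disc_less_bottom:
  assumes "S \<in> L" "T \<in> L" "S \<preceq> T" "S \<noteq> T" "torsion_free S T" "interval_semistable S T"
    and U: "U \<in> L" "S \<preceq> U" "U \<preceq> T" "U \<noteq> S" and l: "real_slope S T < l"
  shows "disc l U < disc l S"
proof -
  have "0 < (l - real_slope S T) * real_of_int (c0 U - c0 S)"
    using l torsion_free_rank_less[OF assms(5,1)] U by simp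
  then show ?thesis
    using semistable_disc_le(1)[OF assms(1-9) refl] disc_change[of l U S "real_slope S T"]
    by (simp add: algebra_simps)
qed

text \<open>
  The canonical elements in increasing order of rank; the rank determines a canonical element.
\<close>

definition canonical_list :: "'a list" where
  "canonical_list = map (inv_into canonicals c0) (sorted_list_of_set (c0 ` canonicals))"

text \<open>
  If the \<open>i\<close>-th step has slope \<open>mu i\<close>, then \<open>Es ! i\<close> is canonical for every parameter \<open>l\<close> with
  \<open>mu (i + 1) < l \<le> mu i\<close>, where the condition at either end of the chain is void: up to \<open>Es ! i\<close> each
  step raises \<open>disc l\<close> or leaves it unchanged, beyond \<open>Es ! i\<close> each step lowers it. These ranges of
  parameters exhaust the reals, so the members of the chain are exactly the canonical elements, and
  the order of the list is the order of ranks.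
\<close>

lemma HN_chain_members:
  assumes len: "length Es = Suc m" "m \<ge> 1" and EL: "set Es \<subseteq> L"
    and le: "\<And>i. i \<in> {1..m} \<Longrightarrow> Es ! (i - 1) \<preceq> Es ! i" and top: "Es ! m = greatest"
    and bot: "c0 (Es ! 0) = 0"
    and tf: "\<And>i. i \<in> {1..m} \<Longrightarrow> torsion_free (Es ! (i - 1)) (Es ! i)"
    and ss: "\<And>i. i \<in> {1..m} \<Longrightarrow> interval_semistable (Es ! (i - 1)) (Es ! i)"
    and dec: "\<And>i. i \<in> {1..<m} \<Longrightarrow> interval_slope (Es ! (i - 1)) (Es ! i) > interval_slope (Es ! i) (Es ! Suc i)"
    and ne: "\<And>i. i \<in> {1..m} \<Longrightarrow> Es ! (i - 1) \<noteq> Es ! i"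
  shows "Es = canonical_list"
proof -
  have inL: "Es ! i \<in> L" if "i \<le> m" for i using that EL len nth_mem[of i Es] by auto
  have rank: "c0 (Es ! (i - 1)) < c0 (Es ! i)" if "i \<in> {1..m}" for i
    using torsion_free_rank_less[OF tf[OF that]] le[OF that] ne[OF that] inL[of i] inL[of "i-1"] that le_refl
    by force
  define mu where "mu = (\<lambda>i. real_slope (Es ! (i - 1)) (Es ! i))"
  have step: "mu (Suc i) < mu i" if "i \<in> {1..<m}" for i
    using dec[OF that] interval_slope_real rank[of i] rank[of "Suc i"] that by (simp add: mu_def)
  have mu_less: "mu j < mu i" if "1 \<le> i" "i < j" "j \<le> m" for i j
    using that(2,3)
  proof (induction j)
    case (Suc j)
    have "mu (Suc j) < mu j" if "i \<noteq> Suc j" "j \<noteq> 0"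
      using step[of j] that Suc.prems by auto
    then show ?case using Suc \<open>1 \<le> i\<close> by (cases "i = j") auto
  qed simp
  have can: "canonical l (Es ! i)"
    if i: "i \<le> m" and low: "\<And>j. j \<in> {1..i} \<Longrightarrow> l \<le> mu j" and high: "\<And>j. j \<in> {Suc i..m} \<Longrightarrow> mu j < l" for i l
  proof -
    \<comment> \<open>Any element is compared with the chain by splitting it along a member of the chain.\<close>
    have split: "disc l V = disc l (V \<curlyvee> Es ! j) + disc l (V \<curlywedge> Es ! j) - disc l (Es ! j)"
      if "j \<le> m" "V \<in> L" for V j
      using disc_modular[OF that(2) inL[OF that(1)], of l] by simp
    have below: "disc l W \<le> disc l (Es ! j)" if "j \<le> i" "W \<in> L" "W \<preceq> Es ! j" for W j
      using that
    proof (induction j arbitrary: W)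
      case 0
      then have "c0 W = 0" using c0_mono[of W "Es ! 0"] c0_nonneg[of W] inL[of 0] bot by simp
      then show ?case using disc_mono[of W "Es ! 0"] 0 bot inL by simp
    next
      case (Suc j)
      have j: "Suc j \<in> {1..m}" "Suc j \<in> {1..i}" "j \<le> m" using Suc.prems i by auto
      note E = inL[OF j(3)] inL[of "Suc j"]
      have "W \<curlyvee> Es ! j \<preceq> Es ! Suc j"
        using join_least[OF Suc.prems(2) E(1)] le[OF j(1)] Suc.prems E(2) j by simp
      then have "disc l (W \<curlyvee> Es ! j) \<le> disc l (Es ! Suc j)"
        using semistable_disc_le_top[of "Es ! j" "Es ! Suc j" "W \<curlyvee> Es ! j" l]
          le[OF j(1)] ne[OF j(1)] tf[OF j(1)] ss[OF j(1)] low[OF j(2)] E j Suc.prems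
          join_in join_right by (simp add: mu_def)
      moreover have "disc l (W \<curlywedge> Es ! j) \<le> disc l (Es ! j)"
        using Suc.IH[of "W \<curlywedge> Es ! j"] Suc.prems E by (simp add: meet_in meet_right)
      ultimately show ?case using split[OF j(3) Suc.prems(2)] by simp
    qed
    have above: "disc l V < disc l (Es ! i) \<or> disc l V = disc l (Es ! i) \<and> V \<preceq> Es ! i"
      if "i \<le> j" "j \<le> m" "V \<in> L" "V \<preceq> Es ! j" for V j
      using that
    proof (induction j arbitrary: V rule: dec_induct)
      case base
      then show ?case using below[of i V] by force
    next
      case (step j)
      have j: "Suc j \<in> {1..m}" "Suc j \<in> {Suc i..m}" "j \<le> m" using step by auto
      note E = inL[OF j(3)] inL[of "Suc j"]
      show ?case
      proof (cases "V \<preceq> Es ! j")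
        case True then show ?thesis using step j by blast
      next
        case False
        have "V \<curlyvee> Es ! j \<preceq> Es ! Suc j"
          using join_least[OF step.prems(2) E(1)] le[OF j(1)] step.prems E(2) j by simp
        moreover have "V \<curlyvee> Es ! j \<noteq> Es ! j" using False le_join_iff_eq step.prems E by blast
        ultimately have "disc l (V \<curlyvee> Es ! j) < disc l (Es ! j)"
          using semistable_disc_less_bottom[of "Es ! j" "Es ! Suc j" "V \<curlyvee> Es ! j" l]
            le[OF j(1)] ne[OF j(1)] tf[OF j(1)] ss[OF j(1)] high[OF j(2)] E j step.prems
            join_in join_right by (simp add: mu_def)
        moreover have "disc l (V \<curlywedge> Es ! j) \<le> disc l (Es ! i)"
          using step.IH[of "V \<curlywedge> Es ! j"] step.prems E j by (force simp: meet_in meet_right)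
        ultimately show ?thesis using split[OF j(3) step.prems(2)] by simp
      qed
    qed
    show ?thesis
      using above[of m] top le_greatest i by (intro canonicalI inL) auto
  qed
  have "set Es = canonicals"
  proof
    show "set Es \<subseteq> canonicals"
    proof
      fix S assume "S \<in> set Es"
      then obtain i where i: "i \<le> m" "S = Es ! i" using len by (metis in_set_conv_nth less_Suc_eq_le)
      \<comment> \<open>The first member of the chain belongs to all parameters above the largest slope.\<close>
      have "canonical (if i = 0 then mu 1 + 1 else mu i) (Es ! i)"
      proof (rule can[OF i(1)])
        fix j assume "j \<in> {1..i}"
        then show "(if i = 0 then mu 1 + 1 else mu i) \<le> mu j"
          using mu_less[of j i] i(1) by (cases "j = i") auto
      next
        fix j assume "j \<in> {Suc i..m}"
        then show "mu j < (if i = 0 then mu 1 + 1 else mu i)"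
          using mu_less[of i j] mu_less[of 1 j] by (cases "j = 1") force+
      qed
      then show "S \<in> canonicals" using i by (auto simp: canonicals_def)
    qed
    show "canonicals \<subseteq> set Es"
    proof
      fix S assume "S \<in> canonicals"
      then obtain l where S: "canonical l S" by (auto simp: canonicals_def)
      define i where "i = Max {j. j \<le> m \<and> (j = 0 \<or> l \<le> mu j)}"
      have fin: "finite {j. j \<le> m \<and> (j = 0 \<or> l \<le> mu j)}" by simp
      have mem: "i \<le> m \<and> (i = 0 \<or> l \<le> mu i)"
        using Max_in[OF fin] unfolding i_def by blast
      have "canonical l (Es ! i)"
      proof (rule can)
        show "i \<le> m" using mem by simp
        fix j assume "j \<in> {1..i}"
        then show "l \<le> mu j" using mu_less[of j i] mem by (cases "j = i") force+
      next
        fix j assume j: "j \<in> {Suc i..m}"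
        then have "j \<notin> {j. j \<le> m \<and> (j = 0 \<or> l \<le> mu j)}"
          using Max_ge[OF fin, of j] unfolding i_def[symmetric] by auto
        then show "mu j < l" using j by auto
      qed
      then have "S = Es ! i" using S canonical_unique by blast
      then show "S \<in> set Es" using mem len by simp
    qed
  qed
  moreover have "sorted_wrt (<) (map c0 Es)"
  proof -
    have "c0 (Es ! i) < c0 (Es ! Suc i)" if "Suc i < length Es" for i
      using rank[of "Suc i"] that len by simp
    then show ?thesis by (simp add: sorted_wrt_iff_nth_Suc_transp)
  qed
  ultimately have "map c0 Es = sorted_list_of_set (c0 ` canonicals)"
    using finite_c0_canonicals
    by (intro strict_sorted_equal[OF strict_sorted_list_of_set]) simp_all
  moreover have "map (inv_into canonicals c0) (map c0 Es) = Es"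
    using \<open>set Es = canonicals\<close> inj_on_c0_canonicals by (auto intro: map_idI)
  ultimately show ?thesis unfolding canonical_list_def by simp
qed

text \<open>
  In positive rank this is \<open>HN_chain_members\<close>. When the greatest element has rank zero, all slopes are infinite: they cannot decrease strictly, so
  there is one step, and it is trivial because it is torsion free.
\<close>

lemma HN_chain_unique:
  assumes "HN_chain Es"
  shows "Es = (if c0 greatest = 0 then [greatest, greatest] else canonical_list)"
proof -
  obtain m where m: "m \<ge> 1" "length Es = Suc m" "set Es \<subseteq> L" "Es ! m = greatest" "c0 (Es ! 0) = 0"
    and le: "\<forall>i\<in>{1..m}. Es ! (i - 1) \<preceq> Es ! i"
    and tf: "\<forall>i\<in>{1..m}. torsion_free (Es ! (i - 1)) (Es ! i) \<and> interval_semistable (Es ! (i - 1)) (Es ! i)"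
    and dec: "\<forall>i\<in>{1..<m}. interval_slope (Es ! (i - 1)) (Es ! i) > interval_slope (Es ! i) (Es ! Suc i)"
    and ne: "c0 greatest \<noteq> 0 \<longrightarrow> (\<forall>i\<in>{1..m}. Es ! (i - 1) \<noteq> Es ! i)"
    using assms unfolding HN_chain_def by blast
  show ?thesis
  proof (cases "c0 greatest = 0")
    case False
    then show ?thesis using HN_chain_members[OF m(2,1,3)] m(4,5) le tf dec ne by simp
  next
    case True
    have zero: "c0 (Es ! i) = 0" if "i \<le> m" for i
    proof -
      have "Es ! i \<in> L" using that m(2,3) nth_mem[of i Es] by auto
      then show ?thesis using c0_mono[of "Es ! i" greatest] c0_nonneg[of "Es ! i"] True greatest_in le_greatest by force
    qed
    have "\<not> 1 < m"
    proof
      assume "1 < m"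
      then have "interval_slope (Es ! 0) (Es ! 1) > interval_slope (Es ! 1) (Es ! 2)"
        using dec[rule_format, of 1] by (simp add: numeral_2_eq_2)
      then show False using zero \<open>1 < m\<close> by (simp add: interval_slope_def)
    qed
    then have "m = 1" using m by simp
    then have "torsion_free (Es ! 0) greatest" "Es ! 0 \<preceq> greatest" "Es ! 1 = greatest" using tf m le by auto
    then have "Es ! 0 = greatest" using True m(5) greatest_in le_refl unfolding torsion_free_def by metis
    then have "Es = [greatest, greatest]" using m(2) \<open>m = 1\<close> \<open>Es ! 1 = greatest\<close>
      by (auto simp: list_eq_iff_nth_eq less_Suc_eq)
    then show ?thesis using True by simp
  qed
qed

text \<open>
  Let \<open>mu\<close> be the slope between consecutive canonical elements \<open>S\<close> and \<open>T\<close>. Their own parameters lie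
  above \<open>mu\<close> and at most \<open>mu\<close> respectively, so the canonical element at \<open>mu\<close> lies between them. It is not
  \<open>S\<close>, since \<open>T\<close> has the same value of \<open>disc mu\<close>. Thus \<open>S\<close> and \<open>T\<close> both maximise \<open>disc mu\<close>, which is
  the semistability of the interval.
\<close>

lemma canonical_slope:
  assumes S: "S \<in> canonicals" and T: "T \<in> canonicals" and less: "c0 S < c0 T"
    and gap: "\<And>R. R \<in> canonicals \<Longrightarrow> c0 R \<le> c0 S \<or> c0 T \<le> c0 R"
  shows "canonical (real_slope S T) T"
proof -
  define mu where "mu = real_slope S T"
  obtain s t where s: "canonical s S" and t: "canonical t T" using S T by (auto simp: canonicals_def)
  have L: "S \<in> L" "T \<in> L" using s t canonical_in by auto
  obtain R where R: "canonical mu R" using canonical_exists by blast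
  then have RM: "R \<in> canonicals" by (auto simp: canonicals_def)
  have nle: "\<not> T \<preceq> S" using less c0_mono[of T S] L by linarith
  have "t \<le> mu" using canonical_max[OF t L(1)] disc_le_iff_slope(1)[OF less] by (simp add: mu_def)
  then have RT: "R \<preceq> T" using canonical_antimono[OF R t] by simp
  have "\<not> s \<le> mu"
    using canonical_greatest[OF s L(2)] nle disc_le_iff_slope(1)[OF less] by (auto simp: mu_def)
  have "disc mu S = disc mu T" using disc_le_iff_slope[OF less, of mu] by (auto simp: mu_def)
  then have "R \<noteq> S" using nle canonical_greatest[OF R L(2)] by force
  moreover have "S \<preceq> R" using \<open>\<not> s \<le> mu\<close> canonical_antimono[OF s R] by simp
  then have "c0 S \<le> c0 R" using canonicals_le_iff S RM by blast
  ultimately have "c0 T \<le> c0 R" using gap[OF RM] inj_onD[OF inj_on_c0_canonicals _ S RM] by force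
  then have "R = T" using RT canonicals_le_iff[OF T RM] le_antisym L canonical_in[OF R] by blast
  then show ?thesis using R by (simp add: mu_def)
qed

text \<open>
  In positive rank the canonical elements form the chain. A step is semistable and slopes decrease by
  \<open>canonical_slope\<close>; a step is torsion free because nothing strictly above a canonical element has the
  same rank.
\<close>

lemma HN_chain_exists: "\<exists>Es. HN_chain Es"
proof (cases "c0 greatest = 0")
  case True
  have "HN_chain [greatest, greatest]"
    unfolding HN_chain_def
  proof (intro exI[of _ 1])
    show "1 \<le> (1::nat) \<and> length [greatest, greatest] = Suc 1 \<and> set [greatest, greatest] \<subseteq> L \<and>
     (\<forall>i\<in>{1..1}. [greatest, greatest] ! (i - 1) \<preceq> [greatest, greatest] ! i) \<and>
     [greatest, greatest] ! 1 = greatest \<and> c0 ([greatest, greatest] ! 0) = 0 \<and>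
     (\<forall>i\<in>{1..1}. torsion_free ([greatest, greatest] ! (i - 1)) ([greatest, greatest] ! i) \<and>
        interval_semistable ([greatest, greatest] ! (i - 1)) ([greatest, greatest] ! i)) \<and>
     (\<forall>i\<in>{1..<1}. interval_slope ([greatest, greatest] ! (i - 1)) ([greatest, greatest] ! i)
        > interval_slope ([greatest, greatest] ! i) ([greatest, greatest] ! Suc i)) \<and>
     (c0 greatest \<noteq> 0 \<longrightarrow> (\<forall>i\<in>{1..1}. [greatest, greatest] ! (i - 1) \<noteq> [greatest, greatest] ! i))"
      using True greatest_in le_refl le_antisym
      by (auto simp: torsion_free_def interval_semistable_def)
  qed
  then show ?thesis by blast
next
  case False
  define Es where "Es = canonical_list"
  define m where "m = length Es - 1"
  define rs where "rs = sorted_list_of_set (c0 ` canonicals)"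
  have rs: "set rs = c0 ` canonicals" "sorted_wrt (<) rs"
    using finite_c0_canonicals by (simp_all add: rs_def)
  have Es: "Es = map (inv_into canonicals c0) rs" by (simp add: Es_def canonical_list_def rs_def)
  have Esmap: "map c0 Es = rs" unfolding Es using rs(1)
    by (auto intro!: map_idI simp: f_inv_into_f)
  have setEs: "set Es = canonicals"
    by (simp add: Es rs(1) image_image inj_on_c0_canonicals)
  have rank: "c0 (Es ! i) < c0 (Es ! j) \<longleftrightarrow> i < j" if "i < length Es" "j < length Es" for i j
    using sorted_wrt_nth_less[OF rs(2)] that Esmap
    by (metis length_map less_asym linorder_neqE_nat nth_map order_less_irrefl)
  have idx: "\<exists>i<length Es. S = Es ! i" if "S \<in> canonicals" for S
    using that setEs by (metis in_set_conv_nth)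
  have mem: "Es ! i \<in> canonicals" if "i < length Es" for i using that setEs nth_mem by blast
  obtain z where z: "z < length Es" "c0 (Es ! z) = 0" using canonical_rank_zero idx by metis
  have bot: "c0 (Es ! 0) = 0"
  proof -
    have "0 < length Es" using z(1) by linarith
    then have "Es ! 0 \<in> L" "\<not> c0 (Es ! z) < c0 (Es ! 0)"
      using mem[of 0] canonicals_in rank[of z 0] z(1) by auto
    then show ?thesis using z(2) c0_nonneg[of "Es ! 0"] by simp
  qed
  obtain t where t: "t < length Es" "Es ! t = greatest" using greatest_canonical idx by metis
  have "t = m"
  proof (rule ccontr)
    assume "t \<noteq> m"
    then have "t < m" "m < length Es" using t by (auto simp: m_def)
    then have "c0 greatest < c0 (Es ! m)" using rank[of t m] t by simp
    moreover have "Es ! m \<in> L" using mem canonicals_in \<open>m < length Es\<close> by blast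
    ultimately show False using c0_mono le_greatest greatest_in by force
  qed
  have len: "length Es = Suc m" using t by (simp add: m_def)
  have "m \<noteq> 0" using t \<open>t = m\<close> bot False by metis
  have slope: "canonical (real_slope (Es ! (i - 1)) (Es ! i)) (Es ! i)"
    and less: "c0 (Es ! (i - 1)) < c0 (Es ! i)" if i: "i \<in> {1..m}" for i
  proof -
    have i': "i < length Es" "i - 1 < length Es" using i len by auto
    show l: "c0 (Es ! (i - 1)) < c0 (Es ! i)" using rank[OF i'(2,1)] i by simp
    have "c0 R \<le> c0 (Es ! (i - 1)) \<or> c0 (Es ! i) \<le> c0 R" if "R \<in> canonicals" for R
    proof -
      obtain j where "j < length Es" "R = Es ! j" using idx[OF \<open>R \<in> canonicals\<close>] by blast
      then show ?thesis using rank[OF i'(2), of j] rank[OF _ i'(1), of j] by force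
    qed
    then show "canonical (real_slope (Es ! (i - 1)) (Es ! i)) (Es ! i)"
      using canonical_slope[OF mem[OF i'(2)] mem[OF i'(1)] l] by blast
  qed
  have "HN_chain Es"
    unfolding HN_chain_def
  proof (intro exI[of _ m] conjI ballI impI)
    show "1 \<le> m" using \<open>m \<noteq> 0\<close> by simp
    show "length Es = Suc m" by (rule len)
    show "set Es \<subseteq> L" using setEs canonicals_in by simp
    show "Es ! m = greatest" using t \<open>t = m\<close> by simp
    show "c0 (Es ! 0) = 0" by (rule bot)
  next
    fix i assume i: "i \<in> {1..m}"
    then have i': "i < length Es" "i - 1 < length Es" using len by auto
    note M = mem[OF i'(2)] mem[OF i'(1)]
    have L: "Es ! (i - 1) \<in> L" "Es ! i \<in> L" using M canonicals_in by auto
    show "Es ! (i - 1) \<preceq> Es ! i" using canonicals_le_iff[OF M] less[OF i] by simp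
    show "Es ! (i - 1) \<noteq> Es ! i" using less[OF i] by auto
    show tf: "torsion_free (Es ! (i - 1)) (Es ! i)"
      using M(1) canonical_rank_maximal unfolding torsion_free_def canonicals_def by blast
    show "interval_semistable (Es ! (i - 1)) (Es ! i)"
      unfolding interval_semistable_def
    proof (intro ballI impI, elim conjE)
      fix U assume U: "U \<in> L" "Es ! (i - 1) \<preceq> U" "U \<preceq> Es ! i" "U \<noteq> Es ! (i - 1)"
      define mu where "mu = real_slope (Es ! (i - 1)) (Es ! i)"
      have lessU: "c0 (Es ! (i - 1)) < c0 U" using torsion_free_rank_less[OF tf L(1)] U by blast
      have "disc mu U \<le> disc mu (Es ! i)" using canonical_max[OF slope[OF i] U(1)] by (simp add: mu_def)
      also have "\<dots> \<le> disc mu (Es ! (i - 1))"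
        using disc_le_iff_slope(2)[OF less[OF i]] by (simp add: mu_def)
      finally have "real_slope (Es ! (i - 1)) U \<le> mu" using disc_le_iff_slope(2)[OF lessU] by simp
      then show "interval_slope (Es ! (i - 1)) U \<le> interval_slope (Es ! (i - 1)) (Es ! i)"
        using interval_slope_real[OF lessU] interval_slope_real[OF less[OF i]] by (simp add: mu_def)
    qed
  next
    fix i assume "i \<in> {1..<m}"
    then have i: "i \<in> {1..m}" "Suc i \<in> {1..m}" by auto
    let ?a = "real_slope (Es ! (i - 1)) (Es ! i)" and ?b = "real_slope (Es ! i) (Es ! Suc i)"
    have "\<not> ?a \<le> ?b"
    proof
      assume "?a \<le> ?b"
      then have "Es ! Suc i \<preceq> Es ! i"
        using canonical_antimono[OF _ slope[OF i(1)]] slope[OF i(2)] by simp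
      moreover have "Es ! i \<in> L" "Es ! Suc i \<in> L"
        using mem[of i] mem[of "Suc i"] canonicals_in i len by auto
      ultimately show False using less[OF i(2)] c0_mono[of "Es ! Suc i" "Es ! i"] by simp
    qed
    then show "interval_slope (Es ! i) (Es ! Suc i) < interval_slope (Es ! (i - 1)) (Es ! i)"
      using interval_slope_real less[OF i(1)] less[OF i(2)] by simp
  qed
  then show ?thesis by blast
qed

text \<open>
  This describes \<open>E\<^sub>0\<^sub>1\<close> inside \<open>E\<^sub>0\<close>.
\<close>

definition null_part :: "'a \<Rightarrow> 'a \<Rightarrow> bool" where
  "null_part N S \<longleftrightarrow> N \<in> L \<and> N \<preceq> S \<and> c0 N = 0 \<and> c1 N = 0 \<and> null_free N S"

text \<open>
  On elements of rank zero the degree is nonnegative and modular, so a join of elements of degree zero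
  has degree zero; null-freeness then forbids \<open>U \<curlyvee> N\<close> to exceed \<open>N\<close>.
\<close>

lemma null_part_greatest:
  assumes S: "S \<in> L" "c0 S = 0" and N: "null_part N S" and U: "U \<in> L" "U \<preceq> S" "c0 U = 0" "c1 U = 0"
  shows "U \<preceq> N"
proof -
  have NL: "N \<in> L" "N \<preceq> S" "c0 N = 0" "c1 N = 0" using N by (auto simp: null_part_def)
  have J: "U \<curlyvee> N \<in> L" "U \<curlyvee> N \<preceq> S" "N \<preceq> U \<curlyvee> N" using U NL S join_in join_least join_right by auto
  have M: "U \<curlywedge> N \<in> L" using U NL meet_in by auto
  have "c0 (U \<curlyvee> N) = 0" "c0 (U \<curlywedge> N) = 0"
    using c0_modular[OF U(1) NL(1)] c0_nonneg[OF J(1)] c0_nonneg[OF M] U NL by auto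
  moreover from this have "c1 (U \<curlyvee> N) = 0"
    using c1_modular[OF U(1) NL(1)] c1_nonneg[OF J(1)] c1_nonneg[OF M] U NL by auto
  ultimately have "U \<curlyvee> N = N" using N J unfolding null_part_def null_free_def by auto
  then show ?thesis using le_join_iff_eq U NL by blast
qed

lemma null_part_ex1:
  assumes S: "S \<in> L" "c0 S = 0"
  shows "\<exists>!N. null_part N S"
proof -
  define P where "P = {U\<in>L. U \<preceq> S \<and> c0 U = 0 \<and> c1 U = 0}"
  have "least \<in> P" using S by (simp add: P_def least_in least_le c0_least c1_least)
  moreover have "U \<curlyvee> V \<in> P" if "U \<in> P" "V \<in> P" for U V
  proof -
    have UV: "U \<in> L" "V \<in> L" "U \<curlyvee> V \<in> L" "U \<curlywedge> V \<in> L" "U \<curlyvee> V \<preceq> S"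
      using that S by (auto simp: P_def join_in meet_in join_least)
    have z: "c0 (U \<curlyvee> V) = 0" "c0 (U \<curlywedge> V) = 0"
      using c0_modular[OF UV(1,2)] c0_nonneg[OF UV(3)] c0_nonneg[OF UV(4)] that by (auto simp: P_def)
    then have "c1 (U \<curlyvee> V) = 0"
      using c1_modular[OF UV(1,2)] c1_nonneg[OF UV(3)] c1_nonneg[OF UV(4)] that by (auto simp: P_def)
    then show ?thesis using UV z by (simp add: P_def)
  qed
  ultimately obtain G where G: "G \<in> P" and max: "\<And>U. U \<in> P \<Longrightarrow> U \<preceq> G"
    using greatest_of_join_closed[of P] by (auto simp: P_def)
  have "null_part G S"
    using G max le_antisym by (auto simp: null_part_def null_free_def P_def)
  moreover have "N = N'" if "null_part N S" "null_part N' S" for N N'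
    using null_part_greatest[OF S that(1), of N'] null_part_greatest[OF S that(2), of N] that le_antisym
    by (auto simp: null_part_def)
  ultimately show ?thesis by blast
qed

theorem HN_chain_ex1: "\<exists>!F. case F of (N, Es) \<Rightarrow> HN_chain Es \<and> null_part N (Es ! 0)"
proof -
  obtain Es where Es: "HN_chain Es" using HN_chain_exists by blast
  have uniq: "Es' = Es" if "HN_chain Es'" for Es' using HN_chain_unique Es that by metis
  have "Es ! 0 \<in> L" "c0 (Es ! 0) = 0"
  proof -
    have "set Es \<subseteq> L" "Es \<noteq> []" using Es unfolding HN_chain_def by auto
    then show "Es ! 0 \<in> L" using nth_mem[of 0 Es] by auto
    show "c0 (Es ! 0) = 0" using Es unfolding HN_chain_def by blast
  qed
  then obtain N where N: "null_part N (Es ! 0)" "\<And>N'. null_part N' (Es ! 0) \<Longrightarrow> N' = N"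
    using null_part_ex1 by metis
  show ?thesis
  proof (rule ex1I[of _ "(N, Es)"])
    show "case (N, Es) of (N, Es) \<Rightarrow> HN_chain Es \<and> null_part N (Es ! 0)" using Es N(1) by simp
    fix F assume F: "case F of (N, Es) \<Rightarrow> HN_chain Es \<and> null_part N (Es ! 0)"
    obtain N' Es' where "F = (N', Es')" by (cases F)
    then show "F = (N, Es)" using F uniq N(2) by blast
  qed
qed

end

section \<open>Kernels, cokernels and images\<close>

context category
begin

lemma Hom_arr: "f \<in> Hom C X Y \<Longrightarrow> f \<in> Arr C" "f \<in> Hom C X Y \<Longrightarrow> Dom C f = X" "f \<in> Hom C X Y \<Longrightarrow> Cod C f = Y"
  by (auto simp: Hom_def)

lemma Hom_obj: "f \<in> Hom C X Y \<Longrightarrow> X \<in> Obj C" "f \<in> Hom C X Y \<Longrightarrow> Y \<in> Obj C"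
  using Dom_closed Cod_closed by (auto simp: Hom_def)

lemma mono_arrI_cancel:
  assumes "f \<in> Hom C X Y"
    and "\<And>W g h. \<lbrakk>g \<in> Hom C W X; h \<in> Hom C W X; f \<cdot> g = f \<cdot> h\<rbrakk> \<Longrightarrow> g = h"
  shows "mono_arr C f"
  using assms(2) Hom_arr[OF assms(1)] unfolding mono_arr_def by simp

lemma epi_arrI_cancel:
  assumes "f \<in> Hom C X Y"
    and "\<And>W g h. \<lbrakk>g \<in> Hom C Y W; h \<in> Hom C Y W; g \<cdot> f = h \<cdot> f\<rbrakk> \<Longrightarrow> g = h"
  shows "epi_arr C f"
  using assms(2) Hom_arr[OF assms(1)] unfolding epi_arr_def by simp

lemma mono_cancel:
  assumes "mono_arr C f" "f \<in> Hom C X Y" "g \<in> Hom C W X" "h \<in> Hom C W X" "f \<cdot> g = f \<cdot> h"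
  shows "g = h"
  using assms Hom_arr[OF assms(2)] unfolding mono_arr_def by blast

lemma epi_cancel:
  assumes "epi_arr C f" "f \<in> Hom C X Y" "g \<in> Hom C Y W" "h \<in> Hom C Y W" "g \<cdot> f = h \<cdot> f"
  shows "g = h"
  using assms Hom_arr[OF assms(2)] unfolding epi_arr_def by blast

lemma mono_comp:
  assumes "mono_arr C f" "f \<in> Hom C X Y" "mono_arr C g" "g \<in> Hom C Y Z"
  shows "mono_arr C (g \<cdot> f)"
proof (rule mono_arrI_cancel)
  show "g \<cdot> f \<in> Hom C X Z" using Comp_in_Hom[OF assms(2,4)] .
  fix W a b assume ab: "a \<in> Hom C W X" "b \<in> Hom C W X" "(g \<cdot> f) \<cdot> a = (g \<cdot> f) \<cdot> b"
  then have "g \<cdot> (f \<cdot> a) = g \<cdot> (f \<cdot> b)" using Comp_assoc[OF _ assms(2,4)] by simp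
  then show "a = b"
    using mono_cancel[OF assms(1,2) ab(1,2)] mono_cancel[OF assms(3,4)] Comp_in_Hom[OF _ assms(2)] ab(1,2)
    by blast
qed

lemma epi_comp:
  assumes "epi_arr C f" "f \<in> Hom C X Y" "epi_arr C g" "g \<in> Hom C Y Z"
  shows "epi_arr C (g \<cdot> f)"
proof (rule epi_arrI_cancel)
  show "g \<cdot> f \<in> Hom C X Z" using Comp_in_Hom[OF assms(2,4)] .
  fix W a b assume ab: "a \<in> Hom C Z W" "b \<in> Hom C Z W" "a \<cdot> (g \<cdot> f) = b \<cdot> (g \<cdot> f)"
  then have "(a \<cdot> g) \<cdot> f = (b \<cdot> g) \<cdot> f" using Comp_assoc[OF assms(2,4)] by simp
  then show "a = b"
    using epi_cancel[OF assms(3,4) ab(1,2)] epi_cancel[OF assms(1,2)] Comp_in_Hom[OF assms(4)] ab(1,2)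
    by blast
qed

lemma mono_right_factor:
  assumes f: "f \<in> Hom C X Y" and g: "g \<in> Hom C Y Z" and m: "mono_arr C (g \<cdot> f)"
  shows "mono_arr C f"
proof (rule mono_arrI_cancel[OF f])
  fix W a b assume ab: "a \<in> Hom C W X" "b \<in> Hom C W X" "f \<cdot> a = f \<cdot> b"
  then have "(g \<cdot> f) \<cdot> a = (g \<cdot> f) \<cdot> b" using Comp_assoc[OF _ f g] by simp
  then show "a = b" using mono_cancel[OF m Comp_in_Hom[OF f g] ab(1,2)] by blast
qed

lemma mono_Ident:
  assumes "X \<in> Obj C" shows "mono_arr C (Ident C X)"
  using Ident_left by (intro mono_arrI_cancel[OF Ident_in_Hom[OF assms]]) simp

lemma epi_Ident:
  assumes "X \<in> Obj C" shows "epi_arr C (Ident C X)"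
  using Ident_right by (intro epi_arrI_cancel[OF Ident_in_Hom[OF assms]]) simp

lemma factors_throughD:
  assumes "factors_through C s t" "s \<in> Hom C X E" "t \<in> Hom C Y E"
  obtains u where "u \<in> Hom C X Y" "t \<cdot> u = s"
  using assms(1) Hom_arr(2)[OF assms(2)] Hom_arr(2)[OF assms(3)] unfolding factors_through_def by auto

lemma factors_throughI:
  assumes "u \<in> Hom C X Y" "t \<in> Hom C Y E" shows "factors_through C (t \<cdot> u) t"
  using assms(1) Hom_arr(2)[OF assms(2)] Hom_arr(2)[OF Comp_in_Hom[OF assms]]
  unfolding factors_through_def by auto

end

context preadditive_category
begin

lemma zero_in_Hom: "\<lbrakk>X \<in> Obj C; Y \<in> Obj C\<rbrakk> \<Longrightarrow> ZeroArr C X Y \<in> Hom C X Y"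
  using comm_group.axioms(2)[OF hom_comm_group] group.is_monoid monoid.one_closed
  by (fastforce simp: hom_group_def)

lemma Add_self_zero:
  assumes "f \<in> Hom C X Y" "AddArr C f f = f" shows "f = ZeroArr C X Y"
proof -
  interpret G: comm_group "hom_group C X Y" using hom_comm_group assms(1) Hom_obj by blast
  have "f \<otimes>\<^bsub>hom_group C X Y\<^esub> f = f" "f \<in> carrier (hom_group C X Y)"
    using assms by (simp_all add: hom_group_def)
  then have "f = \<one>\<^bsub>hom_group C X Y\<^esub>" by (metis G.l_cancel_one)
  then show ?thesis by (simp add: hom_group_def)
qed

lemma Comp_zero:
  assumes "h \<in> Hom C Y Z" "X \<in> Obj C" shows "h \<cdot> ZeroArr C X Y = ZeroArr C X Z"
proof (rule Add_self_zero)
  have Y: "Y \<in> Obj C" using assms Hom_obj by blast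
  note z = zero_in_Hom[OF assms(2) Y]
  interpret G: comm_group "hom_group C X Y" using hom_comm_group assms(2) Y by blast
  have "AddArr C (ZeroArr C X Y) (ZeroArr C X Y) = ZeroArr C X Y"
    using G.l_one[of "\<one>\<^bsub>hom_group C X Y\<^esub>"] z by (simp add: hom_group_def)
  then show "AddArr C (h \<cdot> ZeroArr C X Y) (h \<cdot> ZeroArr C X Y) = h \<cdot> ZeroArr C X Y"
    using Comp_Add_right[OF z z assms(1)] by simp
  show "h \<cdot> ZeroArr C X Y \<in> Hom C X Z" using Comp_in_Hom[OF z assms(1)] .
qed

lemma zero_Comp:
  assumes "h \<in> Hom C X Y" "Z \<in> Obj C" shows "ZeroArr C Y Z \<cdot> h = ZeroArr C X Z"
proof (rule Add_self_zero)
  have Y: "Y \<in> Obj C" using assms Hom_obj by blast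
  note z = zero_in_Hom[OF Y assms(2)]
  interpret G: comm_group "hom_group C Y Z" using hom_comm_group assms(2) Y by blast
  have "AddArr C (ZeroArr C Y Z) (ZeroArr C Y Z) = ZeroArr C Y Z"
    using G.l_one[of "\<one>\<^bsub>hom_group C Y Z\<^esub>"] z by (simp add: hom_group_def)
  then show "AddArr C (ZeroArr C Y Z \<cdot> h) (ZeroArr C Y Z \<cdot> h) = ZeroArr C Y Z \<cdot> h"
    using Comp_Add_left[OF assms(1) z z] by simp
  show "ZeroArr C Y Z \<cdot> h \<in> Hom C X Z" using Comp_in_Hom[OF assms(1) z] .
qed

lemma difference:
  assumes f: "f \<in> Hom C X Y" and g: "g \<in> Hom C X Y"
  obtains d where "d \<in> Hom C X Y" "AddArr C d g = f" "d = ZeroArr C X Y \<Longrightarrow> f = g"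
proof -
  interpret G: comm_group "hom_group C X Y" using hom_comm_group f Hom_obj by blast
  let ?G = "hom_group C X Y"
  have c: "f \<in> carrier ?G" "g \<in> carrier ?G" using f g by (simp_all add: hom_group_def)
  define d where "d = f \<otimes>\<^bsub>?G\<^esub> inv\<^bsub>?G\<^esub> g"
  have dc: "d \<in> carrier ?G" and eq: "d \<otimes>\<^bsub>?G\<^esub> g = f" using c by (simp_all add: d_def G.m_assoc)
  have "f = g" if "d = \<one>\<^bsub>?G\<^esub>" using eq c that by simp
  then show thesis using that[of d] dc eq by (simp add: hom_group_def)
qed

lemma Add_cancel_zero:
  assumes "d \<in> Hom C X Y" "g \<in> Hom C X Y" "AddArr C d g = g" shows "d = ZeroArr C X Y"
proof -
  interpret G: comm_group "hom_group C X Y" using hom_comm_group assms Hom_obj by blast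
  have "d = \<one>\<^bsub>hom_group C X Y\<^esub>"
    using G.l_cancel_one[of g d] G.r_cancel_one[of g d] assms by (simp add: hom_group_def)
  then show ?thesis by (simp add: hom_group_def)
qed

text \<open>
  Two arrows with equal composites differ by an arrow whose composite vanishes.
\<close>

lemma mono_arrI:
  assumes f: "f \<in> Hom C X Y" and z: "\<And>W d. \<lbrakk>d \<in> Hom C W X; f \<cdot> d = ZeroArr C W Y\<rbrakk> \<Longrightarrow> d = ZeroArr C W X"
  shows "mono_arr C f"
proof (rule mono_arrI_cancel[OF f])
  fix W g h assume gh: "g \<in> Hom C W X" "h \<in> Hom C W X" "f \<cdot> g = f \<cdot> h"
  obtain d where d: "d \<in> Hom C W X" "AddArr C d h = g" "d = ZeroArr C W X \<Longrightarrow> g = h"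
    using difference gh(1,2) by blast
  have "AddArr C (f \<cdot> d) (f \<cdot> h) = f \<cdot> h" using Comp_Add_right[OF d(1) gh(2) f] d(2) gh(3) by simp
  then have "f \<cdot> d = ZeroArr C W Y" using Add_cancel_zero Comp_in_Hom f d(1) gh(2) by blast
  then show "g = h" using z d by blast
qed

lemma epi_arrI:
  assumes f: "f \<in> Hom C X Y" and z: "\<And>W d. \<lbrakk>d \<in> Hom C Y W; d \<cdot> f = ZeroArr C X W\<rbrakk> \<Longrightarrow> d = ZeroArr C Y W"
  shows "epi_arr C f"
proof (rule epi_arrI_cancel[OF f])
  fix W g h assume gh: "g \<in> Hom C Y W" "h \<in> Hom C Y W" "g \<cdot> f = h \<cdot> f"
  obtain d where d: "d \<in> Hom C Y W" "AddArr C d h = g" "d = ZeroArr C Y W \<Longrightarrow> g = h"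
    using difference gh(1,2) by blast
  have "AddArr C (d \<cdot> f) (h \<cdot> f) = h \<cdot> f" using Comp_Add_left[OF f d(1) gh(2)] d(2) gh(3) by simp
  then have "d \<cdot> f = ZeroArr C X W" using Add_cancel_zero Comp_in_Hom f d(1) gh(2) by blast
  then show "g = h" using z d by blast
qed

lemma mono_zero_cancel:
  assumes "mono_arr C f" "f \<in> Hom C X Y" "d \<in> Hom C W X" "f \<cdot> d = ZeroArr C W Y"
  shows "d = ZeroArr C W X"
proof -
  have "W \<in> Obj C" "X \<in> Obj C" using assms Hom_obj by blast+
  then show ?thesis using mono_cancel[OF assms(1-3) zero_in_Hom] Comp_zero[OF assms(2)] assms(4) by metis
qed

lemma epi_zero_cancel:
  assumes "epi_arr C f" "f \<in> Hom C X Y" "d \<in> Hom C Y W" "d \<cdot> f = ZeroArr C X W"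
  shows "d = ZeroArr C Y W"
proof -
  have "W \<in> Obj C" "Y \<in> Obj C" using assms Hom_obj by blast+
  then show ?thesis using epi_cancel[OF assms(1-3) zero_in_Hom] zero_Comp[OF assms(2)] assms(4) by metis
qed

lemma zero_object_iff: "zero_object C Z \<longleftrightarrow> Z \<in> Obj C \<and> Ident C Z = ZeroArr C Z Z"
proof
  assume "zero_object C Z"
  then have Z: "Z \<in> Obj C" and "\<exists>!f. f \<in> Hom C Z Z" by (auto simp: zero_object_def)
  then show "Z \<in> Obj C \<and> Ident C Z = ZeroArr C Z Z" using Ident_in_Hom[OF Z] zero_in_Hom[OF Z Z] by blast
next
  assume Z: "Z \<in> Obj C \<and> Ident C Z = ZeroArr C Z Z"
  have "f = ZeroArr C X Z" if "f \<in> Hom C X Z" for f X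
    using Ident_left[OF that] zero_Comp[OF that] Z by metis
  moreover have "f = ZeroArr C Z X" if "f \<in> Hom C Z X" for f X
    using Ident_right[OF that] Comp_zero[OF that] Z by metis
  ultimately show "zero_object C Z" unfolding zero_object_def using Z zero_in_Hom by blast
qed

lemma mono_zero_zero_object:
  assumes "mono_arr C f" "f \<in> Hom C X Y" "f = ZeroArr C X Y" shows "zero_object C X"
proof -
  have X: "X \<in> Obj C" using assms Hom_obj by blast
  have "f \<cdot> Ident C X = ZeroArr C X Y" using Ident_right[OF assms(2)] assms(3) by simp
  then show ?thesis using mono_zero_cancel[OF assms(1,2) Ident_in_Hom[OF X]] X zero_object_iff by blast
qed

lemma epi_zero_zero_object:
  assumes "epi_arr C f" "f \<in> Hom C X Y" "f = ZeroArr C X Y" shows "zero_object C Y"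
proof -
  have Y: "Y \<in> Obj C" using assms Hom_obj by blast
  have "Ident C Y \<cdot> f = ZeroArr C X Y" using Ident_left[OF assms(2)] assms(3) by simp
  then show ?thesis using epi_zero_cancel[OF assms(1,2) Ident_in_Hom[OF Y]] Y zero_object_iff by blast
qed

lemma zero_object_Hom_to:
  assumes "zero_object C Z" "f \<in> Hom C X Z" shows "f = ZeroArr C X Z"
proof -
  have "ZeroArr C Z Z \<cdot> f = ZeroArr C X Z" using zero_Comp assms Hom_obj(2) by blast
  then show ?thesis using Ident_left[OF assms(2)] assms(1) zero_object_iff by simp
qed

lemma zero_object_Hom_from:
  assumes "zero_object C Z" "f \<in> Hom C Z X" shows "f = ZeroArr C Z X"
proof -
  have "f \<cdot> ZeroArr C Z Z = ZeroArr C Z X" using Comp_zero assms Hom_obj(1) by blast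
  then show ?thesis using Ident_right[OF assms(2)] assms(1) zero_object_iff by simp
qed

lemma kernelD:
  assumes "is_kernel C k f" "f \<in> Hom C X Y"
  shows "k \<in> Hom C (Dom C k) X" "f \<cdot> k = ZeroArr C (Dom C k) Y" "mono_arr C k"
proof -
  show k: "k \<in> Hom C (Dom C k) X" and z: "f \<cdot> k = ZeroArr C (Dom C k) Y"
    using assms unfolding is_kernel_def Hom_def by auto
  have ex: "\<exists>!u. u \<in> Hom C W (Dom C k) \<and> k \<cdot> u = g" if "g \<in> Hom C W X" "f \<cdot> g = ZeroArr C W Y" for g W
    using assms(1) that Hom_arr[OF assms(2)] unfolding is_kernel_def by simp
  show "mono_arr C k"
  proof (rule mono_arrI_cancel[OF k])
    fix W g h assume gh: "g \<in> Hom C W (Dom C k)" "h \<in> Hom C W (Dom C k)" "k \<cdot> g = k \<cdot> h"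
    have "f \<cdot> (k \<cdot> g) = ZeroArr C W Y"
      using Comp_assoc[OF gh(1) k assms(2)] z zero_Comp[OF gh(1)] Hom_obj[OF assms(2)] by simp
    then show "g = h" using ex[OF Comp_in_Hom[OF gh(1) k]] gh by auto
  qed
qed

lemma kernel_factor:
  assumes "is_kernel C k f" "f \<in> Hom C X Y" "g \<in> Hom C W X" "f \<cdot> g = ZeroArr C W Y"
  obtains u where "u \<in> Hom C W (Dom C k)" "k \<cdot> u = g"
proof -
  have "\<exists>u. u \<in> Hom C W (Dom C k) \<and> k \<cdot> u = g"
    using assms(1,3,4) Hom_arr[OF assms(2)] unfolding is_kernel_def by blast
  then show thesis using that by blast
qed

lemma is_kernelI:
  assumes f: "f \<in> Hom C X Y" and k: "k \<in> Hom C K X" "mono_arr C k" and z: "f \<cdot> k = ZeroArr C K Y"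
    and ex: "\<And>W g. \<lbrakk>g \<in> Hom C W X; f \<cdot> g = ZeroArr C W Y\<rbrakk> \<Longrightarrow> \<exists>u\<in>Hom C W K. k \<cdot> u = g"
  shows "is_kernel C k f"
proof -
  have "\<exists>!u. u \<in> Hom C W K \<and> k \<cdot> u = g" if "g \<in> Hom C W X" "f \<cdot> g = ZeroArr C W Y" for W g
    using ex[OF that] mono_cancel[OF k(2,1)] by blast
  then show ?thesis unfolding is_kernel_def using z Hom_arr[OF f] Hom_arr[OF k(1)] by simp
qed

lemma cokernelD:
  assumes "is_cokernel C q f" "f \<in> Hom C X Y"
  shows "q \<in> Hom C Y (Cod C q)" "q \<cdot> f = ZeroArr C X (Cod C q)" "epi_arr C q"
proof -
  show q: "q \<in> Hom C Y (Cod C q)" and z: "q \<cdot> f = ZeroArr C X (Cod C q)"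
    using assms unfolding is_cokernel_def Hom_def by auto
  have ex: "\<exists>!u. u \<in> Hom C (Cod C q) W \<and> u \<cdot> q = g" if "g \<in> Hom C Y W" "g \<cdot> f = ZeroArr C X W" for g W
    using assms(1) that Hom_arr[OF assms(2)] unfolding is_cokernel_def by simp
  show "epi_arr C q"
  proof (rule epi_arrI_cancel[OF q])
    fix W g h assume gh: "g \<in> Hom C (Cod C q) W" "h \<in> Hom C (Cod C q) W" "g \<cdot> q = h \<cdot> q"
    have "(g \<cdot> q) \<cdot> f = ZeroArr C X W"
      using Comp_assoc[OF assms(2) q gh(1)] z Comp_zero[OF gh(1)] Hom_obj[OF assms(2)] by simp
    then show "g = h" using ex[OF Comp_in_Hom[OF q gh(1)]] gh by auto
  qed
qed

lemma cokernel_factor: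
  assumes "is_cokernel C q f" "f \<in> Hom C X Y" "g \<in> Hom C Y W" "g \<cdot> f = ZeroArr C X W"
  obtains u where "u \<in> Hom C (Cod C q) W" "u \<cdot> q = g"
proof -
  have "\<exists>u. u \<in> Hom C (Cod C q) W \<and> u \<cdot> q = g"
    using assms(1,3,4) Hom_arr[OF assms(2)] unfolding is_cokernel_def by blast
  then show thesis using that by blast
qed

lemma is_cokernelI:
  assumes f: "f \<in> Hom C X Y" and q: "q \<in> Hom C Y Q" "epi_arr C q" and z: "q \<cdot> f = ZeroArr C X Q"
    and ex: "\<And>W g. \<lbrakk>g \<in> Hom C Y W; g \<cdot> f = ZeroArr C X W\<rbrakk> \<Longrightarrow> \<exists>u\<in>Hom C Q W. u \<cdot> q = g"
  shows "is_cokernel C q f"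
proof -
  have "\<exists>!u. u \<in> Hom C Q W \<and> u \<cdot> q = g" if "g \<in> Hom C Y W" "g \<cdot> f = ZeroArr C X W" for W g
    using ex[OF that] epi_cancel[OF q(2,1)] by blast
  then show ?thesis unfolding is_cokernel_def using z Hom_arr[OF f] Hom_arr[OF q(1)] by simp
qed

end

text \<open>
  These are the real functions on objects induced by homomorphisms from the Grothendieck group.
  Comparing subobjects only needs their values on objects, so the group itself enters just once, in
  \<open>K_class_short_exact\<close>.
\<close>

definition additive_on :: "('o, 'm, 'x) add_cat_scheme \<Rightarrow> ('o \<Rightarrow> real) \<Rightarrow> bool" where
  "additive_on C c \<longleftrightarrow> (\<forall>f g. short_exact C f g \<longrightarrow> c (Cod C f) = c (Dom C f) + c (Cod C g))"

context abelian_category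
begin

lemma kernel_obtain:
  assumes "f \<in> Hom C X Y"
  obtains K k where "is_kernel C k f" "k \<in> Hom C K X" "mono_arr C k" "f \<cdot> k = ZeroArr C K Y"
  using kernel_exists[OF Hom_arr(1)[OF assms]] kernelD[OF _ assms] by blast

lemma cokernel_obtain:
  assumes "f \<in> Hom C X Y"
  obtains Q q where "is_cokernel C q f" "q \<in> Hom C Y Q" "epi_arr C q" "q \<cdot> f = ZeroArr C X Q"
  using cokernel_exists[OF Hom_arr(1)[OF assms]] cokernelD[OF _ assms] by blast

text \<open>
  An epimorphism is the cokernel of some arrow \<open>g\<close>. As \<open>g\<close> factors through the kernel \<open>k\<close>, an arrow
  that vanishes on \<open>k\<close> vanishes on \<open>g\<close>. The next lemma is the dual.
\<close>

lemma epi_kernel_short_exact: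
  assumes "epi_arr C e" "is_kernel C k e"
  shows "short_exact C k e"
proof -
  define X Y where "X = Dom C e" and "Y = Cod C e"
  have e: "e \<in> Hom C X Y" using assms(1) unfolding epi_arr_def X_def Y_def Hom_def by simp
  note k = kernelD[OF assms(2) e]
  obtain g where g: "is_cokernel C e g" using epi_is_cokernel assms(1) by blast
  define W where "W = Dom C g"
  have gH: "g \<in> Hom C W X" using g unfolding is_cokernel_def W_def X_def Hom_def by simp
  have "e \<cdot> g = ZeroArr C W Y" using cokernelD(2)[OF g gH] Y_def by simp
  then obtain u where u: "u \<in> Hom C W (Dom C k)" "k \<cdot> u = g"
    using kernel_factor[OF assms(2) e gH] by blast
  have "is_cokernel C e k"
  proof (rule is_cokernelI[OF k(1) e assms(1) k(2)])
    fix Z h assume h: "h \<in> Hom C X Z" "h \<cdot> k = ZeroArr C (Dom C k) Z"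
    have "h \<cdot> g = ZeroArr C W Z"
      using Comp_assoc[OF u(1) k(1) h(1)] u h(2) zero_Comp[OF u(1)] Hom_obj(2)[OF h(1)] by simp
    then show "\<exists>u\<in>Hom C Y Z. u \<cdot> e = h" using cokernel_factor[OF g gH h(1)] Y_def by metis
  qed
  then show ?thesis using assms(2) by (simp add: short_exact_def)
qed

lemma mono_cokernel_short_exact:
  assumes "mono_arr C m" "is_cokernel C q m"
  shows "short_exact C m q"
proof -
  define X Y where "X = Dom C m" and "Y = Cod C m"
  have m: "m \<in> Hom C X Y" using assms(1) unfolding mono_arr_def X_def Y_def Hom_def by simp
  note q = cokernelD[OF assms(2) m]
  obtain g where g: "is_kernel C m g" using mono_is_kernel assms(1) by blast
  define W where "W = Cod C g"
  have gH: "g \<in> Hom C Y W" using g unfolding is_kernel_def W_def Y_def Hom_def by simp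
  have "g \<cdot> m = ZeroArr C X W" using kernelD(2)[OF g gH] X_def by simp
  then obtain u where u: "u \<in> Hom C (Cod C q) W" "u \<cdot> q = g"
    using cokernel_factor[OF assms(2) m gH] by blast
  have "is_kernel C m q"
  proof (rule is_kernelI[OF q(1) m assms(1) q(2)])
    fix Z h assume h: "h \<in> Hom C Z Y" "q \<cdot> h = ZeroArr C Z (Cod C q)"
    have "g \<cdot> h = ZeroArr C Z W"
      using Comp_assoc[OF h(1) q(1) u(1)] u h(2) Comp_zero[OF u(1)] Hom_obj(1)[OF h(1)] by simp
    then show "\<exists>u\<in>Hom C Z X. m \<cdot> u = h" using kernel_factor[OF g gH h(1)] X_def by metis
  qed
  then show ?thesis using assms(2) by (simp add: short_exact_def)
qed

lemma additive_epi:
  assumes "additive_on C c" "epi_arr C e" "e \<in> Hom C X Y" "is_kernel C k e"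
  shows "c X = c (Dom C k) + c Y"
  using epi_kernel_short_exact[OF assms(2,4)] kernelD(1)[OF assms(4,3)] assms(1,3)
  unfolding additive_on_def by (metis Hom_arr(3))

lemma additive_mono:
  assumes "additive_on C c" "mono_arr C m" "m \<in> Hom C X Y" "is_cokernel C q m"
  shows "c Y = c X + c (Cod C q)"
  using mono_cokernel_short_exact[OF assms(2,4)] assms(1,3)
  unfolding additive_on_def by (metis Hom_arr(2,3))

text \<open>
  Equivalent monomorphisms have the same cokernel, so additivity applies twice with the same third term.
\<close>

lemma additive_mono_equiv:
  assumes "additive_on C c" and s: "mono_arr C s" "s \<in> Hom C X E" and t: "mono_arr C t" "t \<in> Hom C Y E"
    and st: "factors_through C s t" "factors_through C t s"
  shows "c X = c Y"
proof -
  obtain u where u: "u \<in> Hom C X Y" "t \<cdot> u = s" using factors_throughD[OF st(1) s(2) t(2)] .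
  obtain v where v: "v \<in> Hom C Y X" "s \<cdot> v = t" using factors_throughD[OF st(2) t(2) s(2)] .
  obtain Q q where q: "is_cokernel C q s" "q \<in> Hom C E Q" "epi_arr C q" "q \<cdot> s = ZeroArr C X Q"
    using cokernel_obtain[OF s(2)] .
  have "is_cokernel C q t"
  proof (rule is_cokernelI[OF t(2) q(2,3)])
    show "q \<cdot> t = ZeroArr C Y Q"
      using Comp_assoc[OF v(1) s(2) q(2)] v(2) q(4) zero_Comp[OF v(1)] Hom_obj(2)[OF q(2)] by simp
    fix W g assume g: "g \<in> Hom C E W" "g \<cdot> t = ZeroArr C Y W"
    have "g \<cdot> s = ZeroArr C X W"
      using Comp_assoc[OF u(1) t(2) g(1)] u(2) g(2) zero_Comp[OF u(1)] Hom_obj(2)[OF g(1)] by simp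
    then show "\<exists>u\<in>Hom C Q W. u \<cdot> q = g"
      using cokernel_factor[OF q(1) s(2) g(1)] Hom_arr(3)[OF q(2)] by metis
  qed
  then show ?thesis using additive_mono[OF assms(1) s q(1)] additive_mono[OF assms(1) t] by simp
qed

text \<open>
  The zero object is both sub and quotient of itself in a short exact sequence, so \<open>c Z = c Z + c Z\<close>.
\<close>

lemma additive_zero_object:
  assumes "additive_on C c" "zero_object C Z" shows "c Z = 0"
proof -
  have Z: "Z \<in> Obj C" "Ident C Z = ZeroArr C Z Z" using assms(2) zero_object_iff by auto
  note i = Ident_in_Hom[OF Z(1)]
  have "is_kernel C (Ident C Z) (Ident C Z)"
  proof (rule is_kernelI[OF i i mono_Ident[OF Z(1)]])
    show "Ident C Z \<cdot> Ident C Z = ZeroArr C Z Z" using Ident_left[OF i] Z(2) by simp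
    fix W g assume "g \<in> Hom C W Z" then show "\<exists>u\<in>Hom C W Z. Ident C Z \<cdot> u = g" using Ident_left by blast
  qed
  then have "c Z = c (Dom C (Ident C Z)) + c Z" by (rule additive_epi[OF assms(1) epi_Ident[OF Z(1)] i])
  then show ?thesis using Hom_arr(2)[OF i] by simp
qed

text \<open>
  The image \<open>m\<close> is the kernel of the cokernel. To see that \<open>e\<close> is epi, let \<open>h\<close> vanish on \<open>e\<close>, and let
  \<open>k\<close> be its kernel. Then \<open>f\<close> factors through the monomorphism \<open>m \<cdot> k\<close>, which is a kernel of its
  cokernel; that cokernel vanishes on \<open>f\<close>, hence on \<open>m\<close>. So \<open>m\<close> factors through \<open>m \<cdot> k\<close>, which makes
  \<open>k\<close> split epi and \<open>h\<close> zero.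
\<close>

lemma image_factorization:
  assumes f: "f \<in> Hom C X Y"
  obtains I e m where "e \<in> Hom C X I" "epi_arr C e" "m \<in> Hom C I Y" "mono_arr C m" "f = m \<cdot> e"
proof -
  obtain Q q where q: "is_cokernel C q f" "q \<in> Hom C Y Q" "epi_arr C q" "q \<cdot> f = ZeroArr C X Q"
    using cokernel_obtain[OF f] .
  obtain I m where m: "is_kernel C m q" "m \<in> Hom C I Y" "mono_arr C m" "q \<cdot> m = ZeroArr C I Q"
    using kernel_obtain[OF q(2)] .
  obtain e where e: "e \<in> Hom C X I" "m \<cdot> e = f"
    using kernel_factor[OF m(1) q(2) f q(4)] Hom_arr(2)[OF m(2)] by metis
  have "epi_arr C e"
  proof (rule epi_arrI[OF e(1)])
    fix W h assume h: "h \<in> Hom C I W" "h \<cdot> e = ZeroArr C X W"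
    obtain K k where k: "is_kernel C k h" "k \<in> Hom C K I" "mono_arr C k" "h \<cdot> k = ZeroArr C K W"
      using kernel_obtain[OF h(1)] .
    obtain e' where e': "e' \<in> Hom C X K" "k \<cdot> e' = e"
      using kernel_factor[OF k(1) h(1) e(1) h(2)] Hom_arr(2)[OF k(2)] by metis
    define n where "n = m \<cdot> k"
    have n: "n \<in> Hom C K Y" "mono_arr C n" unfolding n_def
      using Comp_in_Hom[OF k(2) m(2)] mono_comp[OF k(3,2) m(3,2)] .
    have fn: "n \<cdot> e' = f" using Comp_assoc[OF e'(1) k(2) m(2)] e'(2) e(2) by (simp add: n_def)
    obtain P p where p: "is_cokernel C p n" "p \<in> Hom C Y P" "epi_arr C p" "p \<cdot> n = ZeroArr C K P"
      using cokernel_obtain[OF n(1)] .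
    have np: "is_kernel C n p" using mono_cokernel_short_exact[OF n(2) p(1)] by (simp add: short_exact_def)
    have P: "P \<in> Obj C" using p(2) Hom_obj by blast
    have "p \<cdot> f = ZeroArr C X P"
      using Comp_assoc[OF e'(1) n(1) p(2)] fn p(4) zero_Comp[OF e'(1) P] by simp
    then obtain r where r: "r \<in> Hom C Q P" "r \<cdot> q = p"
      using cokernel_factor[OF q(1) f p(2)] Hom_arr(3)[OF q(2)] by metis
    have I: "I \<in> Obj C" using m(2) Hom_obj by blast
    have "p \<cdot> m = ZeroArr C I P"
      using Comp_assoc[OF m(2) q(2) r(1)] r(2) m(4) Comp_zero[OF r(1) I] by simp
    then obtain v where v: "v \<in> Hom C I K" "n \<cdot> v = m"
      using kernel_factor[OF np p(2) m(2)] Hom_arr(2)[OF n(1)] by metis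
    have "m \<cdot> (k \<cdot> v) = m \<cdot> Ident C I"
      using Comp_assoc[OF v(1) k(2) m(2)] v(2) Ident_right[OF m(2)] by (simp add: n_def)
    then have "k \<cdot> v = Ident C I"
      using mono_cancel[OF m(3,2) Comp_in_Hom[OF v(1) k(2)] Ident_in_Hom[OF I]] by simp
    then have "h = (h \<cdot> k) \<cdot> v" using Comp_assoc[OF v(1) k(2) h(1)] Ident_right[OF h(1)] by simp
    then show "h = ZeroArr C I W" using k(4) zero_Comp[OF v(1)] Hom_obj(2)[OF h(1)] by simp
  qed
  then show thesis using that e m by blast
qed

lemma comp_epi_zero_iff:
  assumes "e \<in> Hom C X I" "epi_arr C e" "h \<in> Hom C I W"
  shows "h \<cdot> e = ZeroArr C X W \<longleftrightarrow> h = ZeroArr C I W"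
  using epi_zero_cancel[OF assms(2,1,3)] zero_Comp[OF assms(1)] Hom_obj(2)[OF assms(3)] by metis

text \<open>
  The alternating sum along the exact sequence from the kernel to the cokernel of \<open>f\<close> vanishes; it is
  spliced at the image of \<open>f\<close>.
\<close>

lemma additive_four_term:
  assumes c: "additive_on C c" and f: "f \<in> Hom C X Y" and k: "is_kernel C k f" and q: "is_cokernel C q f"
  shows "c X + c (Cod C q) = c Y + c (Dom C k)"
proof -
  obtain I e m where em: "e \<in> Hom C X I" "epi_arr C e" "m \<in> Hom C I Y" "mono_arr C m" "f = m \<cdot> e"
    using image_factorization[OF f] .
  note kD = kernelD[OF k f] and qD = cokernelD[OF q f]
  have zk: "f \<cdot> g = ZeroArr C W Y \<longleftrightarrow> e \<cdot> g = ZeroArr C W I" if g: "g \<in> Hom C W X" for g W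
    using Comp_assoc[OF g em(1,3)] mono_zero_cancel[OF em(4,3) Comp_in_Hom[OF g em(1)]]
      Comp_zero[OF em(3)] Hom_obj(1)[OF g] em(5) by metis
  have zq: "g \<cdot> f = ZeroArr C X W \<longleftrightarrow> g \<cdot> m = ZeroArr C I W" if g: "g \<in> Hom C Y W" for g W
    using Comp_assoc[OF em(1,3) g] comp_epi_zero_iff[OF em(1,2) Comp_in_Hom[OF em(3) g]] em(5) by metis
  have "is_kernel C k e"
    using zk kernel_factor[OF k f] by (intro is_kernelI[OF em(1) kD(1,3)]) (use kD in blast)+
  moreover have "is_cokernel C q m"
    using zq cokernel_factor[OF q f] by (intro is_cokernelI[OF em(3) qD(1,3)]) (use qD in blast)+
  ultimately show ?thesis using additive_epi[OF c em(2,1)] additive_mono[OF c em(4,3)] by simp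
qed

end

section \<open>The lattice of subobjects\<close>

context category
begin

lemma factors_through_refl: "s \<in> Hom C X E \<Longrightarrow> factors_through C s s"
  using factors_throughI[OF Ident_in_Hom, of X s E] Ident_right[of s X E] Hom_obj by simp

lemma factors_through_trans:
  assumes "r \<in> Hom C X E" "s \<in> Hom C Y E" "t \<in> Hom C Z E" "factors_through C r s" "factors_through C s t"
  shows "factors_through C r t"
proof -
  obtain u where u: "u \<in> Hom C X Y" "s \<cdot> u = r" using factors_throughD[OF assms(4,1,2)] .
  obtain v where v: "v \<in> Hom C Y Z" "t \<cdot> v = s" using factors_throughD[OF assms(5,2,3)] .
  have "t \<cdot> (v \<cdot> u) = r" using Comp_assoc[OF u(1) v(1) assms(3)] u v by simp
  then show ?thesis using factors_throughI[OF Comp_in_Hom[OF u(1) v(1)] assms(3)] by simp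
qed

lemma subobj_class_eq_iff:
  assumes s: "mono_arr C s" "s \<in> Hom C X E" and t: "mono_arr C t" "t \<in> Hom C Y E"
  shows "subobj_class C s = subobj_class C t \<longleftrightarrow> factors_through C s t \<and> factors_through C t s"
proof
  assume "subobj_class C s = subobj_class C t"
  moreover have "s \<in> subobj_class C s"
    using s factors_through_refl[OF s(2)] by (simp add: subobj_class_def)
  ultimately show "factors_through C s t \<and> factors_through C t s" by (simp add: subobj_class_def)
next
  assume st: "factors_through C s t \<and> factors_through C t s"
  have "factors_through C s r \<longleftrightarrow> factors_through C t r" "factors_through C r s \<longleftrightarrow> factors_through C r t"
    if "mono_arr C r" "Cod C r = E" for r
  proof -
    have r: "r \<in> Hom C (Dom C r) E" using that by (simp add: mono_arr_def Hom_def)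
    show "factors_through C s r \<longleftrightarrow> factors_through C t r"
      using factors_through_trans[OF s(2) t(2) r] factors_through_trans[OF t(2) s(2) r] st by blast
    show "factors_through C r s \<longleftrightarrow> factors_through C r t"
      using factors_through_trans[OF r s(2) t(2)] factors_through_trans[OF r t(2) s(2)] st by blast
  qed
  then show "subobj_class C s = subobj_class C t"
    using Hom_arr(3)[OF s(2)] Hom_arr(3)[OF t(2)] by (auto simp: subobj_class_def)
qed

lemma subobj_class_in_Sub: "\<lbrakk>mono_arr C s; s \<in> Hom C X E\<rbrakk> \<Longrightarrow> subobj_class C s \<in> Sub C E"
  using Hom_arr(3) unfolding Sub_def by blast

lemma Sub_memberD:
  assumes "S \<in> Sub C E" "t \<in> S"
  shows "mono_arr C t" "t \<in> Hom C (Dom C t) E" "S = subobj_class C t"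
proof -
  obtain s where s: "mono_arr C s" "Cod C s = E" "S = subobj_class C s"
    using assms(1) unfolding Sub_def by blast
  have sH: "s \<in> Hom C (Dom C s) E" using s by (simp add: mono_arr_def Hom_def)
  show t: "mono_arr C t" and tH: "t \<in> Hom C (Dom C t) E"
    using assms(2) s by (auto simp: subobj_class_def mono_arr_def Hom_def)
  show "S = subobj_class C t"
    using subobj_class_eq_iff[OF s(1) sH t tH] assms(2) s(3) by (simp add: subobj_class_def)
qed

definition sub_rep :: "'m set \<Rightarrow> 'm" where
  "sub_rep S = (SOME s. s \<in> S)"

lemma sub_rep:
  assumes "S \<in> Sub C E"
  shows "sub_rep S \<in> S" "mono_arr C (sub_rep S)" "sub_rep S \<in> Hom C (sub_obj C S) E"
    "subobj_class C (sub_rep S) = S"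
proof -
  obtain s where s: "mono_arr C s" "Cod C s = E" "S = subobj_class C s"
    using assms unfolding Sub_def by blast
  have "s \<in> Hom C (Dom C s) E" using s by (simp add: mono_arr_def Hom_def)
  then have "s \<in> S" using s factors_through_refl by (simp add: subobj_class_def)
  then show r: "sub_rep S \<in> S" unfolding sub_rep_def by (rule someI)
  show "mono_arr C (sub_rep S)" "subobj_class C (sub_rep S) = S" using Sub_memberD[OF assms r] by simp_all
  show "sub_rep S \<in> Hom C (sub_obj C S) E"
    using Sub_memberD(2)[OF assms r] by (simp add: sub_obj_def sub_rep_def)
qed

lemma sub_le_iff:
  assumes S: "S \<in> Sub C E" "s \<in> S" and T: "T \<in> Sub C E" "t \<in> T"
  shows "sub_le C S T \<longleftrightarrow> factors_through C s t"
proof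
  assume "sub_le C S T"
  then obtain s' t' where st: "s' \<in> S" "t' \<in> T" "factors_through C s' t'" unfolding sub_le_def by blast
  note s = Sub_memberD[OF S] and t = Sub_memberD[OF T]
  note s' = Sub_memberD[OF S(1) st(1)] and t' = Sub_memberD[OF T(1) st(2)]
  have "factors_through C s s'" "factors_through C t' t"
    using subobj_class_eq_iff[OF s(1,2) s'(1,2)] subobj_class_eq_iff[OF t(1,2) t'(1,2)]
      s(3) s'(3) t(3) t'(3) by simp_all
  then show "factors_through C s t"
    using factors_through_trans s(2) s'(2) t(2) t'(2) st(3) by blast
next
  assume "factors_through C s t" then show "sub_le C S T" using S T unfolding sub_le_def by blast
qed

lemma in_subobj_class: "\<lbrakk>mono_arr C s; s \<in> Hom C X E\<rbrakk> \<Longrightarrow> s \<in> subobj_class C s"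
  using factors_through_refl by (simp add: subobj_class_def)

lemma sub_le_refl: "S \<in> Sub C E \<Longrightarrow> sub_le C S S"
  using sub_le_iff[of S E "sub_rep S" S "sub_rep S"] sub_rep factors_through_refl by blast

lemma sub_le_trans:
  assumes "R \<in> Sub C E" "S \<in> Sub C E" "T \<in> Sub C E" "sub_le C R S" "sub_le C S T"
  shows "sub_le C R T"
  using assms(4,5) sub_rep[OF assms(1)] sub_rep[OF assms(2)] sub_rep[OF assms(3)]
    factors_through_trans sub_le_iff[OF assms(1) _ assms(2)] sub_le_iff[OF assms(2) _ assms(3)]
    sub_le_iff[OF assms(1) _ assms(3)] by blast

lemma sub_le_antisym:
  assumes "S \<in> Sub C E" "T \<in> Sub C E" "sub_le C S T" "sub_le C T S"
  shows "S = T"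
proof -
  note s = sub_rep[OF assms(1)] and t = sub_rep[OF assms(2)]
  have "factors_through C (sub_rep S) (sub_rep T)" "factors_through C (sub_rep T) (sub_rep S)"
    using assms(3,4) sub_le_iff[OF assms(1) s(1) assms(2) t(1)] sub_le_iff[OF assms(2) t(1) assms(1) s(1)]
    by simp_all
  then show ?thesis using subobj_class_eq_iff[OF s(2,3) t(2,3)] s(4) t(4) by simp
qed

lemma whole_sub_in: "E \<in> Obj C \<Longrightarrow> whole_sub C E \<in> Sub C E" "E \<in> Obj C \<Longrightarrow> Ident C E \<in> whole_sub C E"
  unfolding whole_sub_def using mono_Ident Ident_in_Hom subobj_class_in_Sub in_subobj_class by blast+

lemma sub_le_whole:
  assumes "S \<in> Sub C E" shows "sub_le C S (whole_sub C E)"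
proof -
  note s = sub_rep[OF assms]
  have E: "E \<in> Obj C" using s(3) Hom_obj by blast
  have "factors_through C (sub_rep S) (Ident C E)"
    using factors_throughI[OF s(3) Ident_in_Hom[OF E]] Ident_left[OF s(3)] by simp
  then show ?thesis using sub_le_iff[OF assms s(1) whole_sub_in[OF E]] by simp
qed

end

context abelian_category
begin

lemma additive_sub_obj:
  assumes "additive_on C c" "S \<in> Sub C E" "s \<in> S" "s \<in> Hom C X E"
  shows "c (sub_obj C S) = c X"
proof -
  note r = sub_rep[OF assms(2)] and s = Sub_memberD[OF assms(2,3)]
  have "factors_through C (sub_rep S) s" "factors_through C s (sub_rep S)"
    using subobj_class_eq_iff[OF r(2,3) s(1) assms(4)] r(4) s(3) by simp_all
  then show ?thesis using additive_mono_equiv[OF assms(1) r(2,3) s(1) assms(4)] by simp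
qed

text \<open>
  The choice of a zero object is immaterial, since all of them give the same subobject.
\<close>

definition zero_sub where
  "zero_sub E = subobj_class C (ZeroArr C (SOME Z. zero_object C Z) E)"

lemma zero_sub:
  assumes "E \<in> Obj C"
  shows "zero_sub E \<in> Sub C E" "S \<in> Sub C E \<Longrightarrow> sub_le C (zero_sub E) S"
    "additive_on C c \<Longrightarrow> c (sub_obj C (zero_sub E)) = 0"
proof -
  define Z where "Z = (SOME Z. zero_object C Z)"
  have Z: "zero_object C Z" unfolding Z_def using zero_object_exists by (rule someI_ex)
  then have ZO: "Z \<in> Obj C" by (simp add: zero_object_iff)
  let ?z = "ZeroArr C Z E"
  note z = zero_in_Hom[OF ZO assms]
  have mono: "mono_arr C ?z" by (rule mono_arrI[OF z]) (rule zero_object_Hom_to[OF Z])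
  have eq: "zero_sub E = subobj_class C ?z" by (simp add: zero_sub_def Z_def)
  show in_Sub: "zero_sub E \<in> Sub C E" unfolding eq by (rule subobj_class_in_Sub[OF mono z])
  have mem: "?z \<in> zero_sub E" unfolding eq by (rule in_subobj_class[OF mono z])
  show "sub_le C (zero_sub E) S" if S: "S \<in> Sub C E"
  proof -
    note s = sub_rep[OF S]
    have "sub_rep S \<cdot> ZeroArr C Z (sub_obj C S) = ?z" by (rule Comp_zero[OF s(3) ZO])
    then have "factors_through C ?z (sub_rep S)"
      using factors_throughI[OF zero_in_Hom[OF ZO Hom_obj(1)[OF s(3)]] s(3)] by simp
    then show ?thesis using sub_le_iff[OF in_Sub mem S s(1)] by simp
  qed
  show "c (sub_obj C (zero_sub E)) = 0" if "additive_on C c"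
    using additive_sub_obj[OF that in_Sub mem z] additive_zero_object[OF that Z] by simp
qed

text \<open>
  Modularity is part of the definition, simultaneously for all additive functions, so that a single
  choice of joins and meets serves rank and degree.
\<close>

definition is_join_meet where
  "is_join_meet E S T J I \<longleftrightarrow> J \<in> Sub C E \<and> I \<in> Sub C E \<and>
    sub_le C S J \<and> sub_le C T J \<and> sub_le C I S \<and> sub_le C I T \<and>
    (\<forall>W\<in>Sub C E. sub_le C S W \<longrightarrow> sub_le C T W \<longrightarrow> sub_le C J W) \<and>
    (\<forall>W\<in>Sub C E. sub_le C W S \<longrightarrow> sub_le C W T \<longrightarrow> sub_le C W I) \<and>
    (\<forall>c. additive_on C c \<longrightarrow> c (sub_obj C J) + c (sub_obj C I) = c (sub_obj C S) + c (sub_obj C T))"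

text \<open>
  With \<open>q: E \<rightarrow> E/S\<close> and \<open>f = q \<cdot> t: T \<rightarrow> E/S\<close>, the meet is the kernel of \<open>f\<close>, and the join is the kernel of
  the composite of \<open>q\<close> with the cokernel \<open>g\<close> of \<open>f\<close>: an arrow out of \<open>E\<close> that kills \<open>S\<close> and \<open>T\<close>
  factors through that composite. Modularity follows by eliminating \<open>E\<close>, \<open>E/S\<close> and the cokernel of \<open>f\<close>
  from the exact sequences involved.
\<close>

lemma join_meet_exist:
  assumes S: "S \<in> Sub C E" and T: "T \<in> Sub C E"
  shows "\<exists>J I. is_join_meet E S T J I"
proof -
  define X Y s t where "X = sub_obj C S" and "Y = sub_obj C T" and "s = sub_rep S" and "t = sub_rep T"
  have s: "s \<in> S" "mono_arr C s" "s \<in> Hom C X E" and t: "t \<in> T" "mono_arr C t" "t \<in> Hom C Y E"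
    using sub_rep[OF S] sub_rep[OF T] by (simp_all add: X_def Y_def s_def t_def)
  obtain A q where q: "is_cokernel C q s" "q \<in> Hom C E A" "epi_arr C q" "q \<cdot> s = ZeroArr C X A"
    using cokernel_obtain[OF s(3)] .
  have sq: "is_kernel C s q" using mono_cokernel_short_exact[OF s(2) q(1)] by (simp add: short_exact_def)
  define f where "f = q \<cdot> t"
  have f: "f \<in> Hom C Y A" unfolding f_def by (rule Comp_in_Hom[OF t(3) q(2)])
  obtain K i where i: "is_kernel C i f" "i \<in> Hom C K Y" "mono_arr C i" "f \<cdot> i = ZeroArr C K A"
    using kernel_obtain[OF f] .
  obtain B g where g: "is_cokernel C g f" "g \<in> Hom C A B" "epi_arr C g" "g \<cdot> f = ZeroArr C Y B"
    using cokernel_obtain[OF f] .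
  define h where "h = g \<cdot> q"
  have h: "h \<in> Hom C E B" "epi_arr C h"
    unfolding h_def using Comp_in_Hom[OF q(2) g(2)] epi_comp[OF q(3,2) g(3,2)] .
  obtain N j where j: "is_kernel C j h" "j \<in> Hom C N E" "mono_arr C j" "h \<cdot> j = ZeroArr C N B"
    using kernel_obtain[OF h(1)] .
  define J where "J = subobj_class C j"
  have J: "J \<in> Sub C E" "j \<in> J"
    unfolding J_def using subobj_class_in_Sub[OF j(3,2)] in_subobj_class[OF j(3,2)] .
  define n where "n = t \<cdot> i"
  have n: "n \<in> Hom C K E" "mono_arr C n"
    unfolding n_def using Comp_in_Hom[OF i(2) t(3)] mono_comp[OF i(3,2) t(2,3)] .
  define I where "I = subobj_class C n"
  have I: "I \<in> Sub C E" "n \<in> I"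
    unfolding I_def using subobj_class_in_Sub[OF n(2,1)] in_subobj_class[OF n(2,1)] .
  have B: "B \<in> Obj C" using g(2) Hom_obj by blast
  have "h \<cdot> s = ZeroArr C X B"
    using Comp_assoc[OF s(3) q(2) g(2)] q(4) Comp_zero[OF g(2) Hom_obj(1)[OF s(3)]] by (simp add: h_def)
  then have SJ: "factors_through C s j"
    using kernel_factor[OF j(1) h(1) s(3)] factors_throughI j(2) Hom_arr(2)[OF j(2)] by metis
  have "h \<cdot> t = ZeroArr C Y B"
    using Comp_assoc[OF t(3) q(2) g(2)] g(4) by (simp add: h_def f_def)
  then have TJ: "factors_through C t j"
    using kernel_factor[OF j(1) h(1) t(3)] factors_throughI j(2) Hom_arr(2)[OF j(2)] by metis
  have IT: "factors_through C n t" unfolding n_def by (rule factors_throughI[OF i(2) t(3)])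
  have "q \<cdot> n = ZeroArr C K A" using Comp_assoc[OF i(2) t(3) q(2)] i(4) by (simp add: n_def f_def)
  then have IS: "factors_through C n s"
    using kernel_factor[OF sq q(2) n(1)] factors_throughI s(3) Hom_arr(2)[OF s(3)] by metis
  have least: "sub_le C J W" if W: "W \<in> Sub C E" "sub_le C S W" "sub_le C T W" for W
  proof -
    define w V where "w = sub_rep W" and "V = sub_obj C W"
    have w: "w \<in> W" "mono_arr C w" "w \<in> Hom C V E" using sub_rep[OF W(1)] by (simp_all add: w_def V_def)
    obtain D r where r: "is_cokernel C r w" "r \<in> Hom C E D" "epi_arr C r" "r \<cdot> w = ZeroArr C V D"
      using cokernel_obtain[OF w(3)] .
    have wr: "is_kernel C w r" using mono_cokernel_short_exact[OF w(2) r(1)] by (simp add: short_exact_def)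
    have D: "D \<in> Obj C" using r(2) Hom_obj by blast
    have vanish: "r \<cdot> a = ZeroArr C P D" if a: "factors_through C a w" "a \<in> Hom C P E" for a P
    proof -
      obtain u where u: "u \<in> Hom C P V" "w \<cdot> u = a" using factors_throughD[OF a w(3)] .
      then show ?thesis using Comp_assoc[OF u(1) w(3) r(2)] r(4) zero_Comp[OF u(1) D] by simp
    qed
    have "r \<cdot> s = ZeroArr C X D" using vanish sub_le_iff[OF S s(1) W(1) w(1)] W(2) s(3) by blast
    then obtain r' where r': "r' \<in> Hom C A D" "r' \<cdot> q = r"
      using cokernel_factor[OF q(1) s(3) r(2)] Hom_arr(3)[OF q(2)] by metis
    have "r \<cdot> t = ZeroArr C Y D" using vanish sub_le_iff[OF T t(1) W(1) w(1)] W(3) t(3) by blast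
    then have "r' \<cdot> f = ZeroArr C Y D" using Comp_assoc[OF t(3) q(2) r'(1)] r'(2) by (simp add: f_def)
    then obtain r'' where r'': "r'' \<in> Hom C B D" "r'' \<cdot> g = r'"
      using cokernel_factor[OF g(1) f r'(1)] Hom_arr(3)[OF g(2)] by metis
    have "r = r'' \<cdot> h" using Comp_assoc[OF q(2) g(2) r''(1)] r'(2) r''(2) by (simp add: h_def)
    then have "r \<cdot> j = ZeroArr C N D"
      using Comp_assoc[OF j(2) h(1) r''(1)] j(4) Comp_zero[OF r''(1) Hom_obj(1)[OF j(2)]] by simp
    then have "factors_through C j w"
      using kernel_factor[OF wr r(2) j(2)] factors_throughI w(3) Hom_arr(2)[OF w(3)] by metis
    then show ?thesis using sub_le_iff[OF J W(1) w(1)] by simp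
  qed
  have greatest: "sub_le C W I" if W: "W \<in> Sub C E" "sub_le C W S" "sub_le C W T" for W
  proof -
    define w V where "w = sub_rep W" and "V = sub_obj C W"
    have w: "w \<in> W" "mono_arr C w" "w \<in> Hom C V E" using sub_rep[OF W(1)] by (simp_all add: w_def V_def)
    have "factors_through C w s" "factors_through C w t"
      using sub_le_iff[OF W(1) w(1) S s(1)] sub_le_iff[OF W(1) w(1) T t(1)] W by simp_all
    then obtain u v where u: "u \<in> Hom C V X" "s \<cdot> u = w" and v: "v \<in> Hom C V Y" "t \<cdot> v = w"
      using factors_throughD[OF _ w(3) s(3)] factors_throughD[OF _ w(3) t(3)] by metis
    have "q \<cdot> w = ZeroArr C V A"
      using Comp_assoc[OF u(1) s(3) q(2)] u(2) q(4) zero_Comp[OF u(1) Hom_obj(2)[OF q(2)]] by simp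
    then have "f \<cdot> v = ZeroArr C V A" using Comp_assoc[OF v(1) t(3) q(2)] v(2) by (simp add: f_def)
    then obtain x where x: "x \<in> Hom C V K" "i \<cdot> x = v"
      using kernel_factor[OF i(1) f v(1)] Hom_arr(2)[OF i(2)] by metis
    have "n \<cdot> x = w" using Comp_assoc[OF x(1) i(2) t(3)] x(2) v(2) by (simp add: n_def)
    then have "factors_through C w n" using factors_throughI[OF x(1) n(1)] by simp
    then show ?thesis using sub_le_iff[OF W(1) w(1) I] by simp
  qed
  have modular: "c (sub_obj C J) + c (sub_obj C I) = c X + c Y" if c: "additive_on C c" for c
  proof -
    have "c E = c X + c A" using additive_mono[OF c s(2,3) q(1)] Hom_arr(3)[OF q(2)] by simp
    moreover have "c E = c N + c B" using additive_epi[OF c h(2,1) j(1)] Hom_arr(2)[OF j(2)] by simp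
    moreover have "c Y + c B = c A + c K"
      using additive_four_term[OF c f i(1) g(1)] Hom_arr(2)[OF i(2)] Hom_arr(3)[OF g(2)] by simp
    moreover have "c (sub_obj C J) = c N" "c (sub_obj C I) = c K"
      using additive_sub_obj[OF c J j(2)] additive_sub_obj[OF c I n(1)] .
    ultimately show ?thesis by linarith
  qed
  show ?thesis
    unfolding is_join_meet_def
    using J(1) I(1) sub_le_iff[OF S s(1) J] sub_le_iff[OF T t(1) J] sub_le_iff[OF I S s(1)]
      sub_le_iff[OF I T t(1)] SJ TJ IS IT least greatest modular
    by (intro exI[of _ J] exI[of _ I]) (auto simp: X_def Y_def)
qed

definition sub_join where
  "sub_join E S T = (SOME J. \<exists>I. is_join_meet E S T J I)"

definition sub_meet where
  "sub_meet E S T = (SOME I. is_join_meet E S T (sub_join E S T) I)"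

lemma sub_join_meet:
  assumes "S \<in> Sub C E" "T \<in> Sub C E"
  shows "is_join_meet E S T (sub_join E S T) (sub_meet E S T)"
proof -
  have "\<exists>I. is_join_meet E S T (sub_join E S T) I"
    unfolding sub_join_def by (rule someI_ex[OF join_meet_exist[OF assms]])
  then show ?thesis unfolding sub_meet_def by (rule someI_ex)
qed

section \<open>Subobjects of a quotient\<close>

text \<open>
  The preimage of \<open>F\<close> under \<open>q\<close> is the kernel \<open>k\<close> of the composite \<open>h\<close> of \<open>q\<close> with the cokernel \<open>g\<close> of \<open>f\<close>.
  If it is no larger than \<open>X\<close>, then \<open>q\<close> factors through \<open>h = g \<cdot> q\<close>, so \<open>g\<close> is split mono and \<open>f\<close>,
  which \<open>g\<close> kills, is zero.
\<close>

lemma pull_back_subobject: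
  assumes u: "mono_arr C u" "u \<in> Hom C X Y" and q: "is_cokernel C q u" "q \<in> Hom C Y Q"
    and f: "mono_arr C f" "f \<in> Hom C F Q"
  obtains K k where "mono_arr C k" "k \<in> Hom C K Y" "factors_through C u k"
    "\<And>c. additive_on C c \<Longrightarrow> c K = c X + c F" "factors_through C k u \<Longrightarrow> zero_object C F"
proof -
  note qD = cokernelD[OF q(1) u(2)]
  have uq: "is_kernel C u q" using mono_cokernel_short_exact[OF u(1) q(1)] by (simp add: short_exact_def)
  have quz: "q \<cdot> u = ZeroArr C X Q" using qD(2) Hom_arr(3)[OF q(2)] by simp
  obtain B g where g: "is_cokernel C g f" "g \<in> Hom C Q B" "epi_arr C g" "g \<cdot> f = ZeroArr C F B"
    using cokernel_obtain[OF f(2)] .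
  define h where "h = g \<cdot> q"
  have h: "h \<in> Hom C Y B" "epi_arr C h"
    unfolding h_def using Comp_in_Hom[OF q(2) g(2)] epi_comp[OF qD(3) q(2) g(3,2)] .
  obtain K k where k: "is_kernel C k h" "k \<in> Hom C K Y" "mono_arr C k" "h \<cdot> k = ZeroArr C K B"
    using kernel_obtain[OF h(1)] .
  have hk: "is_cokernel C h k" using epi_kernel_short_exact[OF h(2) k(1)] by (simp add: short_exact_def)
  have "h \<cdot> u = ZeroArr C X B"
    using Comp_assoc[OF u(2) q(2) g(2)] quz Comp_zero[OF g(2) Hom_obj(1)[OF u(2)]] by (simp add: h_def)
  then obtain v where v: "v \<in> Hom C X K" "k \<cdot> v = u"
    using kernel_factor[OF k(1) h(1) u(2)] Hom_arr(2)[OF k(2)] by metis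
  then have "factors_through C u k" using factors_throughI[OF v(1) k(2)] by simp
  moreover have "c K = c X + c F" if c: "additive_on C c" for c
  proof -
    have "c Y = c X + c Q" using additive_mono[OF c u q(1)] Hom_arr(3)[OF q(2)] by simp
    moreover have "c Q = c F + c B" using additive_mono[OF c f g(1)] Hom_arr(3)[OF g(2)] by simp
    moreover have "c Y = c K + c B" using additive_epi[OF c h(2,1) k(1)] Hom_arr(2)[OF k(2)] by simp
    ultimately show ?thesis by linarith
  qed
  moreover have "zero_object C F" if ku: "factors_through C k u"
  proof -
    obtain w where w: "w \<in> Hom C K X" "u \<cdot> w = k" using factors_throughD[OF ku k(2) u(2)] .
    have Q: "Q \<in> Obj C" and F: "F \<in> Obj C" using Hom_obj[OF f(2)] by auto
    have "q \<cdot> k = ZeroArr C K Q" using Comp_assoc[OF w(1) u(2) q(2)] w(2) quz zero_Comp[OF w(1) Q] by simp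
    then obtain x where x: "x \<in> Hom C B Q" "x \<cdot> h = q"
      using cokernel_factor[OF hk k(2) q(2)] Hom_arr(3)[OF h(1)] by metis
    have "(x \<cdot> g) \<cdot> q = Ident C Q \<cdot> q"
      using Comp_assoc[OF q(2) g(2) x(1)] x(2) Ident_left[OF q(2)] by (simp add: h_def)
    then have "x \<cdot> g = Ident C Q"
      using epi_cancel[OF qD(3) q(2) Comp_in_Hom[OF g(2) x(1)] Ident_in_Hom[OF Q]] by simp
    then have "f = x \<cdot> (g \<cdot> f)" using Comp_assoc[OF f(2) g(2) x(1)] Ident_left[OF f(2)] by simp
    then have "f = ZeroArr C F Q" using g(4) Comp_zero[OF x(1) F] by simp
    then show ?thesis using mono_zero_zero_object[OF f] by simp
  qed
  ultimately show thesis using that k(2,3) by blast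
qed

text \<open>
  The subobject is the image of \<open>K\<close> in \<open>Q\<close>; the kernel of \<open>K \<rightarrow> F\<close> is \<open>X\<close>.
\<close>

lemma push_forward_subobject:
  assumes u: "mono_arr C u" "u \<in> Hom C X Y" and q: "is_cokernel C q u" "q \<in> Hom C Y Q"
    and k: "mono_arr C k" "k \<in> Hom C K Y" and uk: "factors_through C u k"
  obtains F f where "mono_arr C f" "f \<in> Hom C F Q"
    "\<And>c. additive_on C c \<Longrightarrow> c K = c X + c F" "zero_object C F \<Longrightarrow> factors_through C k u"
proof -
  note qD = cokernelD[OF q(1) u(2)]
  have uq: "is_kernel C u q" using mono_cokernel_short_exact[OF u(1) q(1)] by (simp add: short_exact_def)
  have quz: "q \<cdot> u = ZeroArr C X Q" using qD(2) Hom_arr(3)[OF q(2)] by simp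
  obtain w where w: "w \<in> Hom C X K" "k \<cdot> w = u" using factors_throughD[OF uk u(2) k(2)] .
  have wm: "mono_arr C w" using mono_right_factor[OF w(1) k(2)] w(2) u(1) by simp
  have qk: "q \<cdot> k \<in> Hom C K Q" by (rule Comp_in_Hom[OF k(2) q(2)])
  have Q: "Q \<in> Obj C" using q(2) Hom_obj by blast
  obtain F e f where ef: "e \<in> Hom C K F" "epi_arr C e" "f \<in> Hom C F Q" "mono_arr C f" "q \<cdot> k = f \<cdot> e"
    using image_factorization[OF qk] .
  have zero_iff: "e \<cdot> a = ZeroArr C W F \<longleftrightarrow> q \<cdot> (k \<cdot> a) = ZeroArr C W Q" if a: "a \<in> Hom C W K" for a W
    using Comp_assoc[OF a k(2) q(2)] Comp_assoc[OF a ef(1,3)] ef(5)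
      mono_zero_cancel[OF ef(4,3) Comp_in_Hom[OF a ef(1)]] Comp_zero[OF ef(3) Hom_obj(1)[OF a]] by metis
  have "is_kernel C w e"
  proof (rule is_kernelI[OF ef(1) w(1) wm])
    show "e \<cdot> w = ZeroArr C X F" using zero_iff[OF w(1)] w(2) quz by simp
    fix W a assume a: "a \<in> Hom C W K" "e \<cdot> a = ZeroArr C W F"
    then have "q \<cdot> (k \<cdot> a) = ZeroArr C W Q" using zero_iff by simp
    then obtain b where b: "b \<in> Hom C W X" "u \<cdot> b = k \<cdot> a"
      using kernel_factor[OF uq q(2) Comp_in_Hom[OF a(1) k(2)]] Hom_arr(2)[OF u(2)] by metis
    then have "k \<cdot> (w \<cdot> b) = k \<cdot> a" using Comp_assoc[OF b(1) w(1) k(2)] w(2) by simp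
    then have "w \<cdot> b = a" using mono_cancel[OF k Comp_in_Hom[OF b(1) w(1)] a(1)] by simp
    then show "\<exists>b\<in>Hom C W X. w \<cdot> b = a" using b(1) by blast
  qed
  then have "c K = c X + c F" if "additive_on C c" for c
    using additive_epi[OF that ef(2,1)] Hom_arr(2)[OF w(1)] by simp
  moreover have "factors_through C k u" if F: "zero_object C F"
  proof -
    have "f \<cdot> e = ZeroArr C K Q"
      using zero_object_Hom_from[OF F ef(3)] zero_Comp[OF ef(1) Q] by simp
    then obtain x where "x \<in> Hom C K X" "u \<cdot> x = k"
      using kernel_factor[OF uq q(2) k(2)] ef(5) Hom_arr(2)[OF u(2)] by metis
    then show ?thesis using factors_throughI u(2) by metis
  qed
  ultimately show thesis using that ef(3,4) by blast
qed

lemma quot_obj_is_quot_obj: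
  assumes S: "S \<in> Sub C E" and T: "T \<in> Sub C E" and le: "sub_le C S T"
  shows "is_quot_obj C T S (quot_obj C T S)"
proof -
  note s = sub_rep[OF S] and t = sub_rep[OF T]
  obtain u where u: "u \<in> Hom C (sub_obj C S) (sub_obj C T)" "sub_rep T \<cdot> u = sub_rep S"
    using factors_throughD[OF _ s(3) t(3)] sub_le_iff[OF S s(1) T t(1)] le by metis
  obtain Q q where "is_cokernel C q u" "q \<in> Hom C (sub_obj C T) Q" using cokernel_obtain[OF u(1)] by metis
  then have "is_quot_obj C T S Q"
    unfolding is_quot_obj_def using s(1) t(1) u Hom_arr(2)[OF s(3)] Hom_arr(2)[OF t(3)] Hom_arr(3) by metis
  then show ?thesis unfolding quot_obj_def by (rule someI)
qed

text \<open>
  The arrows behind the chosen object \<open>T/S\<close>. Their sources are arbitrary representatives of the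
  subobjects, which need not be the ones chosen by \<open>sub_obj\<close>.
\<close>

lemma quot_obj_arrows:
  assumes S: "S \<in> Sub C E" and T: "T \<in> Sub C E" and le: "sub_le C S T"
  obtains X Y s t u q where "s \<in> S" "mono_arr C s" "s \<in> Hom C X E" "t \<in> T" "mono_arr C t" "t \<in> Hom C Y E"
    "mono_arr C u" "u \<in> Hom C X Y" "t \<cdot> u = s" "is_cokernel C q u" "q \<in> Hom C Y (quot_obj C T S)"
proof -
  obtain s t u q where *: "s \<in> S" "t \<in> T" "u \<in> Hom C (Dom C s) (Dom C t)" "t \<cdot> u = s"
    "is_cokernel C q u" "Cod C q = quot_obj C T S"
    using quot_obj_is_quot_obj[OF assms] unfolding is_quot_obj_def by blast
  note s = Sub_memberD[OF S *(1)] and t = Sub_memberD[OF T *(2)]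
  have "mono_arr C u" using mono_right_factor[OF *(3) t(2)] *(4) s(1) by simp
  moreover have "q \<in> Hom C (Dom C t) (quot_obj C T S)" using cokernelD(1)[OF *(5,3)] *(6) by simp
  ultimately show thesis using that * s t by blast
qed

lemma quot_obj_in:
  assumes "S \<in> Sub C E" "T \<in> Sub C E" "sub_le C S T"
  shows "quot_obj C T S \<in> Obj C"
  using quot_obj_arrows[OF assms] Hom_obj(2) by metis

lemma additive_quot_obj:
  assumes S: "S \<in> Sub C E" and T: "T \<in> Sub C E" and le: "sub_le C S T" and c: "additive_on C c"
  shows "c (quot_obj C T S) = c (sub_obj C T) - c (sub_obj C S)"
proof -
  obtain X Y s t u q where *: "s \<in> S" "mono_arr C s" "s \<in> Hom C X E" "t \<in> T" "mono_arr C t" "t \<in> Hom C Y E"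
    "mono_arr C u" "u \<in> Hom C X Y" "t \<cdot> u = s" "is_cokernel C q u" "q \<in> Hom C Y (quot_obj C T S)"
    using quot_obj_arrows[OF S T le] .
  show ?thesis
    using additive_mono[OF c *(7,8,10)] Hom_arr(3)[OF *(11)] additive_sub_obj[OF c S *(1,3)]
      additive_sub_obj[OF c T *(4,6)] by simp
qed

lemma quot_obj_zero_iff:
  assumes S: "S \<in> Sub C E" and T: "T \<in> Sub C E" and le: "sub_le C S T"
  shows "zero_object C (quot_obj C T S) \<longleftrightarrow> S = T"
proof -
  obtain X Y s t u q where *: "s \<in> S" "mono_arr C s" "s \<in> Hom C X E" "t \<in> T" "mono_arr C t" "t \<in> Hom C Y E"
    "mono_arr C u" "u \<in> Hom C X Y" "t \<cdot> u = s" "is_cokernel C q u" "q \<in> Hom C Y (quot_obj C T S)"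
    using quot_obj_arrows[OF S T le] .
  let ?Q = "quot_obj C T S"
  note qD = cokernelD[OF *(10,8)]
  have uq: "is_kernel C u q" using mono_cokernel_short_exact[OF *(7,10)] by (simp add: short_exact_def)
  have Y: "Y \<in> Obj C" and Q: "?Q \<in> Obj C" using Hom_obj[OF *(11)] by auto
  note idY = Ident_in_Hom[OF Y]
  show ?thesis
  proof
    assume "zero_object C ?Q"
    then have "q \<cdot> Ident C Y = ZeroArr C Y ?Q"
      using zero_object_Hom_to[OF _ *(11)] Ident_right[OF *(11)] by simp
    then obtain x where x: "x \<in> Hom C Y X" "u \<cdot> x = Ident C Y"
      using kernel_factor[OF uq *(11) idY] Hom_arr(2)[OF *(8)] by metis
    have "s \<cdot> x = t" using Comp_assoc[OF x(1) *(8,6)] x(2) Ident_right[OF *(6)] *(9) by simp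
    then have "factors_through C t s" using factors_throughI[OF x(1) *(3)] by simp
    then have "sub_le C T S" using sub_le_iff[OF T *(4) S *(1)] by simp
    then show "S = T" using sub_le_antisym[OF S T le] by simp
  next
    assume "S = T"
    then have "factors_through C t s" using sub_le_iff[OF T *(4) S *(1)] sub_le_refl[OF S] by simp
    then obtain w where w: "w \<in> Hom C Y X" "s \<cdot> w = t" using factors_throughD[OF _ *(6,3)] by blast
    then have "t \<cdot> (u \<cdot> w) = t \<cdot> Ident C Y"
      using Comp_assoc[OF w(1) *(8,6)] Ident_right[OF *(6)] *(9) by simp
    then have "u \<cdot> w = Ident C Y" using mono_cancel[OF *(5,6) Comp_in_Hom[OF w(1) *(8)] idY] by simp
    then have "q = (q \<cdot> u) \<cdot> w" using Comp_assoc[OF w(1) *(8,11)] Ident_right[OF *(11)] by simp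
    also have "\<dots> = ZeroArr C Y ?Q" using qD(2) Hom_arr(3)[OF *(11)] zero_Comp[OF w(1) Q] by simp
    finally show "zero_object C ?Q" by (rule epi_zero_zero_object[OF qD(3) *(11)])
  qed
qed

text \<open>
  Together with the next lemma this is the part of the correspondence between subobjects of \<open>T/S\<close>
  and subobjects between \<open>S\<close> and \<open>T\<close> that slopes depend on: additive functions change by their value
  at \<open>S\<close>, and the zero subobject corresponds to \<open>S\<close> alone.
\<close>

lemma sub_of_quotient_pull_back:
  assumes S: "S \<in> Sub C E" and T: "T \<in> Sub C E" and le: "sub_le C S T" and F: "F \<in> Sub C (quot_obj C T S)"
  shows "\<exists>U\<in>Sub C E. sub_le C S U \<and> sub_le C U T \<and> (U = S \<longrightarrow> zero_object C (sub_obj C F)) \<and>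
    (\<forall>c. additive_on C c \<longrightarrow> c (sub_obj C U) = c (sub_obj C S) + c (sub_obj C F))"
proof -
  obtain X Y s t u q where *: "s \<in> S" "mono_arr C s" "s \<in> Hom C X E" "t \<in> T" "mono_arr C t" "t \<in> Hom C Y E"
    "mono_arr C u" "u \<in> Hom C X Y" "t \<cdot> u = s" "is_cokernel C q u" "q \<in> Hom C Y (quot_obj C T S)"
    using quot_obj_arrows[OF S T le] .
  note f = sub_rep[OF F]
  obtain K k where k: "mono_arr C k" "k \<in> Hom C K Y" "factors_through C u k"
    and ck: "\<And>c. additive_on C c \<Longrightarrow> c K = c X + c (sub_obj C F)"
    and zk: "factors_through C k u \<Longrightarrow> zero_object C (sub_obj C F)"
    using pull_back_subobject[OF *(7,8,10,11) f(2,3)] by blast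
  define m where "m = t \<cdot> k"
  have m: "m \<in> Hom C K E" "mono_arr C m"
    unfolding m_def using Comp_in_Hom[OF k(2) *(6)] mono_comp[OF k(1,2) *(5,6)] .
  define U where "U = subobj_class C m"
  have U: "U \<in> Sub C E" "m \<in> U"
    unfolding U_def using subobj_class_in_Sub[OF m(2,1)] in_subobj_class[OF m(2,1)] .
  obtain w where w: "w \<in> Hom C X K" "k \<cdot> w = u" using factors_throughD[OF k(3) *(8) k(2)] .
  have "m \<cdot> w = s" using Comp_assoc[OF w(1) k(2) *(6)] w(2) *(9) by (simp add: m_def)
  then have "factors_through C s m" using factors_throughI[OF w(1) m(1)] by simp
  then have SU: "sub_le C S U" using sub_le_iff[OF S *(1) U] by simp
  have "factors_through C m t" unfolding m_def by (rule factors_throughI[OF k(2) *(6)])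
  then have UT: "sub_le C U T" using sub_le_iff[OF U T *(4)] by simp
  have "zero_object C (sub_obj C F)" if "U = S"
  proof (rule zk)
    have "factors_through C m s" using sub_le_iff[OF U S *(1)] sub_le_refl[OF S] that by simp
    then obtain x where x: "x \<in> Hom C K X" "s \<cdot> x = m" using factors_throughD[OF _ m(1) *(3)] by blast
    have "t \<cdot> (u \<cdot> x) = t \<cdot> k" using Comp_assoc[OF x(1) *(8,6)] x(2) *(9) by (simp add: m_def)
    then have "u \<cdot> x = k" using mono_cancel[OF *(5,6) Comp_in_Hom[OF x(1) *(8)] k(2)] by simp
    then show "factors_through C k u" using factors_throughI[OF x(1) *(8)] by simp
  qed
  moreover have "c (sub_obj C U) = c (sub_obj C S) + c (sub_obj C F)" if c: "additive_on C c" for c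
    using ck[OF c] additive_sub_obj[OF c U m(1)] additive_sub_obj[OF c S *(1,3)] by simp
  ultimately show ?thesis using U(1) SU UT by blast
qed

lemma sub_of_quotient_push_forward:
  assumes S: "S \<in> Sub C E" and T: "T \<in> Sub C E" and U: "U \<in> Sub C E" "sub_le C S U" "sub_le C U T"
  shows "\<exists>F\<in>Sub C (quot_obj C T S). (zero_object C (sub_obj C F) \<longrightarrow> U = S) \<and>
    (\<forall>c. additive_on C c \<longrightarrow> c (sub_obj C U) = c (sub_obj C S) + c (sub_obj C F))"
proof -
  have le: "sub_le C S T" using sub_le_trans[OF S U(1) T U(2,3)] .
  obtain X Y s t u q where *: "s \<in> S" "mono_arr C s" "s \<in> Hom C X E" "t \<in> T" "mono_arr C t" "t \<in> Hom C Y E"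
    "mono_arr C u" "u \<in> Hom C X Y" "t \<cdot> u = s" "is_cokernel C q u" "q \<in> Hom C Y (quot_obj C T S)"
    using quot_obj_arrows[OF S T le] .
  define m K where "m = sub_rep U" and "K = sub_obj C U"
  have m: "m \<in> U" "mono_arr C m" "m \<in> Hom C K E" using sub_rep[OF U(1)] by (simp_all add: m_def K_def)
  have "factors_through C m t" "factors_through C s m"
    using sub_le_iff[OF U(1) m(1) T *(4)] sub_le_iff[OF S *(1) U(1) m(1)] U by simp_all
  then obtain k w where k: "k \<in> Hom C K Y" "t \<cdot> k = m" and w: "w \<in> Hom C X K" "m \<cdot> w = s"
    using factors_throughD[OF _ m(3) *(6)] factors_throughD[OF _ *(3) m(3)] by metis
  have km: "mono_arr C k" using mono_right_factor[OF k(1) *(6)] k(2) m(2) by simp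
  have "t \<cdot> (k \<cdot> w) = t \<cdot> u" using Comp_assoc[OF w(1) k(1) *(6)] k(2) w(2) *(9) by simp
  then have "k \<cdot> w = u" using mono_cancel[OF *(5,6) Comp_in_Hom[OF w(1) k(1)] *(8)] by simp
  then have uk: "factors_through C u k" using factors_throughI[OF w(1) k(1)] by simp
  obtain G f where f: "mono_arr C f" "f \<in> Hom C G (quot_obj C T S)"
    and cf: "\<And>c. additive_on C c \<Longrightarrow> c K = c X + c G"
    and zf: "zero_object C G \<Longrightarrow> factors_through C k u"
    using push_forward_subobject[OF *(7,8,10,11) km k(1) uk] by blast
  define F where "F = subobj_class C f"
  have F: "F \<in> Sub C (quot_obj C T S)" "f \<in> F"
    unfolding F_def using subobj_class_in_Sub[OF f] in_subobj_class[OF f] .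
  have "U = S" if z: "zero_object C (sub_obj C F)"
  proof -
    note r = sub_rep[OF F(1)]
    have "factors_through C f (sub_rep F)" using sub_le_iff[OF F F(1) r(1)] sub_le_refl[OF F(1)] by simp
    then obtain x where x: "x \<in> Hom C G (sub_obj C F)" "sub_rep F \<cdot> x = f"
      using factors_throughD[OF _ f(2) r(3)] by blast
    have "f = ZeroArr C G (quot_obj C T S)"
      using zero_object_Hom_to[OF z x(1)] x(2) Comp_zero[OF r(3) Hom_obj(1)[OF x(1)]] by simp
    then have "factors_through C k u" using zf mono_zero_zero_object[OF f] by simp
    then obtain y where y: "y \<in> Hom C K X" "u \<cdot> y = k" using factors_throughD[OF _ k(1) *(8)] by blast
    have "s \<cdot> y = m" using Comp_assoc[OF y(1) *(8,6)] y(2) k(2) *(9) by simp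
    then have "factors_through C m s" using factors_throughI[OF y(1) *(3)] by simp
    then have "sub_le C U S" using sub_le_iff[OF U(1) m(1) S *(1)] by simp
    then show ?thesis using sub_le_antisym[OF U(1) S _ U(2)] by simp
  qed
  moreover have "c (sub_obj C U) = c (sub_obj C S) + c (sub_obj C F)" if c: "additive_on C c" for c
    using cf[OF c] additive_sub_obj[OF c F f(2)] additive_sub_obj[OF c S *(1,3)] by (simp add: K_def)
  ultimately show ?thesis using F(1) by blast
qed

text \<open>
  An arrow from an object of \<open>D\<close> to \<open>Q\<close> factors through its image, which lies in \<open>D\<close> because \<open>D\<close> is
  closed under quotients. As isomorphisms are epi, \<open>D\<close> is also closed under isomorphism, so the object
  chosen to represent the image lies in \<open>D\<close> too.
\<close>

lemma right_orth_iff_no_sub: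
  assumes D: "D \<subseteq> Obj C" and Q: "Q \<in> Obj C"
    and quot: "\<And>X Y e. \<lbrakk>X \<in> D; e \<in> Hom C X Y; epi_arr C e\<rbrakk> \<Longrightarrow> Y \<in> D"
  shows "Q \<in> right_orth C D \<longleftrightarrow> (\<forall>F\<in>Sub C Q. sub_obj C F \<in> D \<longrightarrow> zero_object C (sub_obj C F))"
proof
  assume R: "Q \<in> right_orth C D"
  show "\<forall>F\<in>Sub C Q. sub_obj C F \<in> D \<longrightarrow> zero_object C (sub_obj C F)"
  proof (intro ballI impI)
    fix F assume F: "F \<in> Sub C Q" "sub_obj C F \<in> D"
    note f = sub_rep[OF F(1)]
    have "sub_rep F = ZeroArr C (sub_obj C F) Q" using f(3) R F(2) unfolding right_orth_def by blast
    then show "zero_object C (sub_obj C F)" by (rule mono_zero_zero_object[OF f(2,3)])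
  qed
next
  assume R: "\<forall>F\<in>Sub C Q. sub_obj C F \<in> D \<longrightarrow> zero_object C (sub_obj C F)"
  have "f = ZeroArr C X Q" if X: "X \<in> D" and f: "f \<in> Hom C X Q" for f X
  proof -
    obtain I e m where em: "e \<in> Hom C X I" "epi_arr C e" "m \<in> Hom C I Q" "mono_arr C m" "f = m \<cdot> e"
      using image_factorization[OF f] .
    define F where "F = subobj_class C m"
    have F: "F \<in> Sub C Q" "m \<in> F"
      unfolding F_def using subobj_class_in_Sub[OF em(4,3)] in_subobj_class[OF em(4,3)] .
    note r = sub_rep[OF F(1)]
    have "factors_through C m (sub_rep F)" "factors_through C (sub_rep F) m"
      using sub_le_iff[OF F F(1) r(1)] sub_le_iff[OF F(1) r(1) F] sub_le_refl[OF F(1)] by simp_all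
    then obtain a b where a: "a \<in> Hom C I (sub_obj C F)" "sub_rep F \<cdot> a = m"
      and b: "b \<in> Hom C (sub_obj C F) I" "m \<cdot> b = sub_rep F"
      using factors_throughD[OF _ em(3) r(3)] factors_throughD[OF _ r(3) em(3)] by metis
    have O: "sub_obj C F \<in> Obj C" using Hom_obj[OF b(1)] by simp
    have "sub_rep F \<cdot> (a \<cdot> b) = sub_rep F \<cdot> Ident C (sub_obj C F)"
      using Comp_assoc[OF b(1) a(1) r(3)] a(2) b(2) Ident_right[OF r(3)] by simp
    then have ab: "a \<cdot> b = Ident C (sub_obj C F)"
      using mono_cancel[OF r(2,3) Comp_in_Hom[OF b(1) a(1)] Ident_in_Hom[OF O]] by simp
    have "epi_arr C a"
    proof (rule epi_arrI[OF a(1)])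
      fix W d assume d: "d \<in> Hom C (sub_obj C F) W" "d \<cdot> a = ZeroArr C I W"
      have "d = (d \<cdot> a) \<cdot> b" using Comp_assoc[OF b(1) a(1) d(1)] ab Ident_right[OF d(1)] by simp
      then show "d = ZeroArr C (sub_obj C F) W" using d(2) zero_Comp[OF b(1)] Hom_obj(2)[OF d(1)] by simp
    qed
    then have "sub_obj C F \<in> D" using quot[OF quot[OF X em(1,2)] a(1)] by simp
    then have "zero_object C (sub_obj C F)" using R F(1) by blast
    then have "m = ZeroArr C I Q"
      using zero_object_Hom_to[OF _ a(1)] a(2) Comp_zero[OF r(3) Hom_obj(1)[OF a(1)]] by simp
    then show ?thesis using em(5) zero_Comp[OF em(1) Q] by simp
  qed
  then show "Q \<in> right_orth C D" unfolding right_orth_def using Q D zero_in_Hom by blast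
qed

end

section \<open>Additivity on the Grothendieck group\<close>

text \<open>
  The defining relation of the Grothendieck group identifies the coset of the middle term with that of
  the sum of the outer terms.
\<close>

lemma (in abelian_category) K_class_short_exact:
  assumes fg: "short_exact C f g" and h: "h \<in> hom (K_group C) H"
  shows "h (K_class C (Cod C f)) = h (K_class C (Dom C f)) \<otimes>\<^bsub>H\<^esub> h (K_class C (Cod C g))"
proof -
  let ?G = "free_Abelian_group (Obj C)"
  interpret G: comm_group ?G by (rule abelian_free_Abelian_group)
  have k: "is_kernel C f' g' \<Longrightarrow> f' \<in> Arr C \<and> g' \<in> Arr C" for f' g' by (simp add: is_kernel_def)
  have objs: "Cod C f' \<in> Obj C" "Dom C f' \<in> Obj C" "Cod C g' \<in> Obj C" if "short_exact C f' g'" for f' g'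
    using that k Dom_closed Cod_closed unfolding short_exact_def by blast+
  have rel: "K_relations C \<subseteq> carrier ?G"
  proof
    fix x assume "x \<in> K_relations C"
    then obtain f' g' where x: "x = frag_of (Cod C f') - frag_of (Dom C f') - frag_of (Cod C g')"
      "short_exact C f' g'" unfolding K_relations_def by blast
    have "Poly_Mapping.keys x \<subseteq> {Cod C f', Dom C f', Cod C g'}"
      unfolding x(1)
      using keys_diff[of "frag_of (Cod C f') - frag_of (Dom C f')" "frag_of (Cod C g')"]
        keys_diff[of "frag_of (Cod C f')" "frag_of (Dom C f')"] by auto
    then show "x \<in> carrier ?G" using objs[OF x(2)] by (auto simp: carrier_free_Abelian_group_iff)
  qed
  have sg: "subgroup (K_subgroup C) ?G"
    unfolding K_subgroup_def by (rule G.generate_is_subgroup[OF rel])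
  interpret N: normal "K_subgroup C" ?G by (rule G.subgroup_imp_normal[OF sg])
  have car: "frag_of X \<in> carrier ?G" if "X \<in> Obj C" for X using that by (simp add: carrier_free_Abelian_group_iff)
  note o = objs[OF fg]
  let ?y = "frag_of (Cod C f)" and ?x = "frag_of (Dom C f)" and ?z = "frag_of (Cod C g)"
  have xz: "?x + ?z \<in> carrier ?G" using G.m_closed[OF car[OF o(2)] car[OF o(3)]] by simp
  have "?y - ?x - ?z \<in> K_subgroup C"
    unfolding K_subgroup_def by (rule generate.incl) (use fg in \<open>auto simp: K_relations_def\<close>)
  then have "(?y - ?x - ?z) \<otimes>\<^bsub>?G\<^esub> (?x + ?z) \<in> K_subgroup C #>\<^bsub>?G\<^esub> (?x + ?z)"
    by (rule G.rcosI[OF _ N.subset xz])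
  then have "?y \<in> K_subgroup C #>\<^bsub>?G\<^esub> (?x + ?z)" by simp
  then have "K_class C (Cod C f) = K_subgroup C #>\<^bsub>?G\<^esub> (?x + ?z)"
    unfolding K_class_def using G.repr_independence[OF _ xz sg] by simp
  also have "\<dots> = K_class C (Dom C f) \<otimes>\<^bsub>K_group C\<^esub> K_class C (Cod C g)"
    unfolding K_class_def K_group_def using N.rcos_sum[OF car[OF o(2)] car[OF o(3)]]
    by (simp add: FactGroup_def)
  finally have eq: "K_class C (Cod C f) = K_class C (Dom C f) \<otimes>\<^bsub>K_group C\<^esub> K_class C (Cod C g)" .
  have "K_class C X \<in> carrier (K_group C)" if "X \<in> Obj C" for X
    unfolding K_class_def K_group_def FactGroup_def using G.rcosetsI[OF N.subset car[OF that]] by simp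
  then show ?thesis unfolding eq using hom_mult[OF h] o by simp
qed

section \<open>Harder-Narasimhan filtrations of objects\<close>

locale slope_category_object =
  noetherian_abelian_category C + slope_like C C0 C1
  for C :: "('o, 'm, 'x) add_cat_scheme" (structure) and C0 C1 +
  fixes E :: 'o
  assumes E_in: "E \<in> Obj C"
begin

definition rank :: "'o \<Rightarrow> int" where "rank X = C0 (K_class C X)"
definition deg :: "'o \<Rightarrow> real" where "deg X = C1 (K_class C X)"

lemma additive_rank: "additive_on C (\<lambda>X. real_of_int (rank X))"
  and additive_deg: "additive_on C deg"
  unfolding additive_on_def rank_def deg_def
  using K_class_short_exact[OF _ C0_hom] K_class_short_exact[OF _ C1_hom]
  by (simp_all add: real_group_def)

lemma rank_nonneg: "X \<in> Obj C \<Longrightarrow> 0 \<le> rank X"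
  and deg_nonneg: "\<lbrakk>X \<in> Obj C; rank X = 0\<rbrakk> \<Longrightarrow> 0 \<le> deg X"
  using C0_nonneg C1_nonneg by (simp_all add: rank_def deg_def)

lemma rank_quot:
  assumes "S \<in> Sub C X" "T \<in> Sub C X" "sub_le C S T"
  shows "rank (quot_obj C T S) = rank (sub_obj C T) - rank (sub_obj C S)"
  using additive_quot_obj[OF assms additive_rank] by linarith

lemma deg_quot:
  assumes "S \<in> Sub C X" "T \<in> Sub C X" "sub_le C S T"
  shows "deg (quot_obj C T S) = deg (sub_obj C T) - deg (sub_obj C S)"
  using additive_quot_obj[OF assms additive_deg] .

sublocale Sub: slope_lattice "Sub C E" "sub_le C" "sub_join E" "sub_meet E" "zero_sub E" "whole_sub C E"
  "\<lambda>S. rank (sub_obj C S)" "\<lambda>S. deg (sub_obj C S)"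
proof
  fix R S T assume "R \<in> Sub C E" "S \<in> Sub C E" "T \<in> Sub C E" "sub_le C R S" "sub_le C S T"
  then show "sub_le C R T" by (rule sub_le_trans)
next
  fix S T assume ST: "S \<in> Sub C E" "T \<in> Sub C E"
  note JI = sub_join_meet[OF ST, unfolded is_join_meet_def]
  show "sub_join E S T \<in> Sub C E" "sub_meet E S T \<in> Sub C E" "sub_le C S (sub_join E S T)"
    "sub_le C T (sub_join E S T)" "sub_le C (sub_meet E S T) S" "sub_le C (sub_meet E S T) T"
    using JI by simp_all
  show "deg (sub_obj C (sub_join E S T)) + deg (sub_obj C (sub_meet E S T)) = deg (sub_obj C S) + deg (sub_obj C T)"
    using JI additive_deg by simp
  have "real_of_int (rank (sub_obj C (sub_join E S T))) + real_of_int (rank (sub_obj C (sub_meet E S T)))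
      = real_of_int (rank (sub_obj C S)) + real_of_int (rank (sub_obj C T))"
    using JI additive_rank by blast
  then show "rank (sub_obj C (sub_join E S T)) + rank (sub_obj C (sub_meet E S T)) = rank (sub_obj C S) + rank (sub_obj C T)"
    by linarith
  { fix W assume "W \<in> Sub C E" "sub_le C S W" "sub_le C T W"
    then show "sub_le C (sub_join E S T) W" using JI by blast }
  { fix W assume "W \<in> Sub C E" "sub_le C W S" "sub_le C W T"
    then show "sub_le C W (sub_meet E S T)" using JI by blast }
  assume le: "sub_le C S T"
  show "rank (sub_obj C S) \<le> rank (sub_obj C T)"
    using rank_quot[OF ST le] rank_nonneg[OF quot_obj_in[OF ST le]] by simp
  assume "rank (sub_obj C S) = rank (sub_obj C T)"
  then show "deg (sub_obj C S) \<le> deg (sub_obj C T)"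
    using rank_quot[OF ST le] deg_quot[OF ST le] deg_nonneg[OF quot_obj_in[OF ST le]] by simp
next
  fix X :: "nat \<Rightarrow> 'm set" assume "\<And>n. X n \<in> Sub C E" "\<And>n. sub_le C (X n) (X (Suc n))"
  then show "\<exists>N. \<forall>n\<ge>N. X n = X N" by (rule ascending_chain_condition[OF E_in])
next
  show "rank (sub_obj C (zero_sub E)) = 0" using zero_sub(3)[OF E_in additive_rank] by simp
  show "deg (sub_obj C (zero_sub E)) = 0" by (rule zero_sub(3)[OF E_in additive_deg])
next
  fix S assume S: "S \<in> Sub C E"
  show "sub_le C S S" by (rule sub_le_refl[OF S])
  show "sub_le C (zero_sub E) S" by (rule zero_sub(2)[OF E_in S])
  show "sub_le C S (whole_sub C E)" by (rule sub_le_whole[OF S])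
next
  fix S T assume "S \<in> Sub C E" "T \<in> Sub C E" "sub_le C S T" "sub_le C T S"
  then show "S = T" by (rule sub_le_antisym)
next
  show "zero_sub E \<in> Sub C E" by (rule zero_sub(1)[OF E_in])
  show "whole_sub C E \<in> Sub C E" by (rule whole_sub_in(1)[OF E_in])
qed

lemma slope_eq: "slope C C0 C1 X = (if rank X \<noteq> 0 then ereal (deg X / rank X) else \<infinity>)"
  by (simp add: slope_def rank_def deg_def)

lemma slope_quot:
  assumes "S \<in> Sub C E" "T \<in> Sub C E" "sub_le C S T"
  shows "slope C C0 C1 (quot_obj C T S) = Sub.interval_slope S T"
  unfolding slope_eq Sub.interval_slope_def rank_quot[OF assms] deg_quot[OF assms] by simp

text \<open>
  A subobject \<open>F\<close> of \<open>T/S\<close> that corresponds to \<open>U\<close> has the rank, degree and slope of \<open>U/S\<close>.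
\<close>

lemma slope_of_difference:
  assumes "\<forall>c. additive_on C c \<longrightarrow> c (sub_obj C U) = c (sub_obj C S) + c (sub_obj C F)"
  shows "rank (sub_obj C F) = rank (sub_obj C U) - rank (sub_obj C S)"
    "deg (sub_obj C F) = deg (sub_obj C U) - deg (sub_obj C S)"
    "slope C C0 C1 (sub_obj C F) = Sub.interval_slope S U"
proof -
  show r: "rank (sub_obj C F) = rank (sub_obj C U) - rank (sub_obj C S)"
    using assms[rule_format, OF additive_rank] by linarith
  show d: "deg (sub_obj C F) = deg (sub_obj C U) - deg (sub_obj C S)"
    using assms[rule_format, OF additive_deg] by linarith
  show "slope C C0 C1 (sub_obj C F) = Sub.interval_slope S U"
    unfolding slope_eq Sub.interval_slope_def r d by simp
qed

text \<open>
  The correspondence of subobjects matches the tests on both sides. Proper subobjects of \<open>T/S\<close> need not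
  be compared with proper elements of the interval: for \<open>U = T\<close>, and for the whole of \<open>T/S\<close>, both slopes
  agree and the inequality is trivial.
\<close>

lemma semistable_quot_iff:
  assumes ST: "S \<in> Sub C E" "T \<in> Sub C E" "sub_le C S T"
  shows "semistable C C0 C1 (quot_obj C T S) \<longleftrightarrow> Sub.interval_semistable S T"
proof
  assume ss: "semistable C C0 C1 (quot_obj C T S)"
  show "Sub.interval_semistable S T"
    unfolding Sub.interval_semistable_def
  proof (intro ballI impI, elim conjE)
    fix U assume U: "U \<in> Sub C E" "sub_le C S U" "sub_le C U T" "U \<noteq> S"
    obtain F where F: "F \<in> Sub C (quot_obj C T S)" "zero_object C (sub_obj C F) \<longrightarrow> U = S"
      and cF: "\<forall>c. additive_on C c \<longrightarrow> c (sub_obj C U) = c (sub_obj C S) + c (sub_obj C F)"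
      using sub_of_quotient_push_forward[OF ST(1,2) U(1-3)] by blast
    show "Sub.interval_slope S U \<le> Sub.interval_slope S T"
    proof (cases "F = whole_sub C (quot_obj C T S)")
      case True
      note Q = quot_obj_in[OF ST]
      have mem: "Ident C (quot_obj C T S) \<in> F" using whole_sub_in(2)[OF Q] True by simp
      have same: "c (sub_obj C F) = c (quot_obj C T S)" if "additive_on C c" for c
        using additive_sub_obj[OF that F(1) mem Ident_in_Hom[OF Q]] .
      have "rank (sub_obj C F) = rank (quot_obj C T S)" "deg (sub_obj C F) = deg (quot_obj C T S)"
        using same[OF additive_rank] same[OF additive_deg] by simp_all
      then have "slope C C0 C1 (sub_obj C F) = slope C C0 C1 (quot_obj C T S)" by (simp only: slope_eq)
      then show ?thesis using slope_of_difference(3)[OF cF] slope_quot[OF ST] by simp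
    next
      case False
      then show ?thesis
        using ss F U(4) slope_of_difference(3)[OF cF] slope_quot[OF ST] unfolding semistable_def by auto
    qed
  qed
next
  assume ss: "Sub.interval_semistable S T"
  show "semistable C C0 C1 (quot_obj C T S)"
    unfolding semistable_def
  proof (intro conjI ballI impI, rule quot_obj_in[OF ST], elim conjE)
    fix F assume F: "F \<in> Sub C (quot_obj C T S)" "\<not> zero_object C (sub_obj C F)"
    obtain U where U: "U \<in> Sub C E" "sub_le C S U" "sub_le C U T" "U \<noteq> S"
      and cF: "\<forall>c. additive_on C c \<longrightarrow> c (sub_obj C U) = c (sub_obj C S) + c (sub_obj C F)"
      using sub_of_quotient_pull_back[OF ST F(1)] F(2) by blast
    have "Sub.interval_slope S U \<le> Sub.interval_slope S T"
      using ss U unfolding Sub.interval_semistable_def by (cases "U = T") auto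
    then show "slope C C0 C1 (sub_obj C F) \<le> slope C C0 C1 (quot_obj C T S)"
      using slope_of_difference(3)[OF cF] slope_quot[OF ST] by simp
  qed
qed

lemma B0_eq: "B0 C C0 = {X \<in> Obj C. rank X = 0}"
  and B01_eq: "B01 C C0 C1 = {X \<in> Obj C. rank X = 0 \<and> deg X = 0}"
  by (simp_all add: B0_def B01_def rank_def deg_def)

lemma rank_deg_epi:
  assumes "epi_arr C e" "e \<in> Hom C X Y"
  obtains K where "K \<in> Obj C" "rank X = rank K + rank Y" "deg X = deg K + deg Y"
proof -
  obtain K k where k: "is_kernel C k e" "k \<in> Hom C K X" using kernel_obtain[OF assms(2)] by metis
  then show thesis
    using that[of K] additive_epi[OF additive_rank assms k(1)] additive_epi[OF additive_deg assms k(1)]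
      Hom_obj[OF k(2)] Hom_arr(2)[OF k(2)] by (simp flip: of_int_add)
qed

text \<open>
  Kernel and quotient have nonnegative rank, and the two ranks add up to zero. For \<open>B\<^sub>0\<^sub>1\<close> the same
  argument applies once more to the degrees.
\<close>

lemma B0_quotient_closed: "\<lbrakk>X \<in> B0 C C0; e \<in> Hom C X Y; epi_arr C e\<rbrakk> \<Longrightarrow> Y \<in> B0 C C0"
proof -
  assume X: "X \<in> B0 C C0" and e: "e \<in> Hom C X Y" "epi_arr C e"
  obtain K where K: "K \<in> Obj C" "rank X = rank K + rank Y" using rank_deg_epi[OF e(2,1)] by blast
  then show "Y \<in> B0 C C0"
    using X rank_nonneg[of Y] rank_nonneg[of K] Hom_obj(2)[OF e(1)] by (simp add: B0_eq)
qed

lemma B01_quotient_closed: "\<lbrakk>X \<in> B01 C C0 C1; e \<in> Hom C X Y; epi_arr C e\<rbrakk> \<Longrightarrow> Y \<in> B01 C C0 C1"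
proof -
  assume X: "X \<in> B01 C C0 C1" and e: "e \<in> Hom C X Y" "epi_arr C e"
  obtain K where K: "K \<in> Obj C" "rank X = rank K + rank Y" "deg X = deg K + deg Y"
    using rank_deg_epi[OF e(2,1)] by blast
  have Y: "Y \<in> Obj C" using Hom_obj(2)[OF e(1)] .
  have "rank K = 0" "rank Y = 0" using X K(1,2) rank_nonneg[OF Y] rank_nonneg[OF K(1)] by (auto simp: B01_eq)
  then show "Y \<in> B01 C C0 C1"
    using X K Y deg_nonneg[OF Y] deg_nonneg[OF K(1)] by (simp add: B01_eq)
qed

text \<open>
  Membership in \<open>B\<^sub>0\<close> and \<open>B\<^sub>0\<^sub>1\<close> depends only on rank and degree; \<open>P\<close> stands for either condition.
\<close>

lemma orth_quot_iff:
  assumes ST: "S \<in> Sub C E" "T \<in> Sub C E" "sub_le C S T"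
    and D: "D = {X \<in> Obj C. P (rank X) (deg X)}"
    and quot: "\<And>X Y e. \<lbrakk>X \<in> D; e \<in> Hom C X Y; epi_arr C e\<rbrakk> \<Longrightarrow> Y \<in> D"
  shows "quot_obj C T S \<in> right_orth C D \<longleftrightarrow> (\<forall>U\<in>Sub C E. sub_le C S U \<and> sub_le C U T \<and>
    P (rank (sub_obj C U) - rank (sub_obj C S)) (deg (sub_obj C U) - deg (sub_obj C S)) \<longrightarrow> U = S)"
    (is "_ \<longleftrightarrow> ?R")
proof -
  have sub: "D \<subseteq> Obj C" by (auto simp: D)
  have "(\<forall>F\<in>Sub C (quot_obj C T S). sub_obj C F \<in> D \<longrightarrow> zero_object C (sub_obj C F)) \<longleftrightarrow> ?R"
    (is "?L \<longleftrightarrow> _")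
  proof
    assume L: ?L
    show ?R
    proof (intro ballI impI, elim conjE)
      fix U assume U: "U \<in> Sub C E" "sub_le C S U" "sub_le C U T"
        "P (rank (sub_obj C U) - rank (sub_obj C S)) (deg (sub_obj C U) - deg (sub_obj C S))"
      obtain F where F: "F \<in> Sub C (quot_obj C T S)" "zero_object C (sub_obj C F) \<longrightarrow> U = S"
        and cF: "\<forall>c. additive_on C c \<longrightarrow> c (sub_obj C U) = c (sub_obj C S) + c (sub_obj C F)"
        using sub_of_quotient_push_forward[OF ST(1,2) U(1-3)] by blast
      have "sub_obj C F \<in> D"
        using Hom_obj(1)[OF sub_rep(3)[OF F(1)]] slope_of_difference(1,2)[OF cF] U(4) by (simp add: D)
      then show "U = S" using L F by blast
    qed
  next
    assume R: ?R
    show ?L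
    proof (intro ballI impI)
      fix F assume F: "F \<in> Sub C (quot_obj C T S)" "sub_obj C F \<in> D"
      obtain U where U: "U \<in> Sub C E" "sub_le C S U" "sub_le C U T" "U = S \<longrightarrow> zero_object C (sub_obj C F)"
        and cF: "\<forall>c. additive_on C c \<longrightarrow> c (sub_obj C U) = c (sub_obj C S) + c (sub_obj C F)"
        using sub_of_quotient_pull_back[OF ST F(1)] by blast
      have "P (rank (sub_obj C U) - rank (sub_obj C S)) (deg (sub_obj C U) - deg (sub_obj C S))"
        using slope_of_difference(1,2)[OF cF] F(2) by (simp add: D)
      then show "zero_object C (sub_obj C F)" using R U by blast
    qed
  qed
  then show ?thesis by (simp only: right_orth_iff_no_sub[OF sub quot_obj_in[OF ST] quot])
qed

lemma B0_orth_quot_iff: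
  assumes "S \<in> Sub C E" "T \<in> Sub C E" "sub_le C S T"
  shows "quot_obj C T S \<in> right_orth C (B0 C C0) \<longleftrightarrow> Sub.torsion_free S T"
  using orth_quot_iff[OF assms, of "B0 C C0" "\<lambda>r d. r = 0", OF B0_eq B0_quotient_closed]
  by (simp add: Sub.torsion_free_def)

lemma B01_orth_quot_iff:
  assumes "S \<in> Sub C E" "T \<in> Sub C E" "sub_le C S T"
  shows "quot_obj C T S \<in> right_orth C (B01 C C0 C1) \<longleftrightarrow> Sub.null_free S T"
  using orth_quot_iff[OF assms, of "B01 C C0 C1" "\<lambda>r d. r = 0 \<and> d = 0", OF B01_eq B01_quotient_closed]
  by (simp add: Sub.null_free_def)

lemma rank_whole: "rank (sub_obj C (whole_sub C E)) = rank E"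
  using additive_sub_obj[OF additive_rank whole_sub_in[OF E_in] Ident_in_Hom[OF E_in]] by simp

text \<open>
  Condition by condition, the definition of a Harder-Narasimhan filtration translates into the
  lattice of subobjects. The condition that \<open>E\<^sub>0/E\<^sub>0\<^sub>1\<close> has rank zero is the one that changes its form: as
  \<open>E\<^sub>0\<^sub>1\<close> has rank zero, it becomes a condition on \<open>E\<^sub>0\<close> alone.
\<close>

lemma HN_filtration_iff:
  "HN_filtration C C0 C1 E (N, Es) \<longleftrightarrow> Sub.HN_chain Es \<and> Sub.null_part N (Es ! 0)"
proof -
  \<comment> \<open>The shared conditions, under which all quotients that occur are defined.\<close>
  define base where "base m \<longleftrightarrow> m \<ge> 1 \<and> length Es = Suc m \<and> set Es \<subseteq> Sub C E \<and>
    (\<forall>i\<in>{1..m}. sub_le C (Es ! (i - 1)) (Es ! i)) \<and> N \<in> Sub C E \<and> sub_le C N (Es ! 0)" for m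
  have L: "HN_filtration C C0 C1 E (N, Es) \<longleftrightarrow> (\<exists>m. base m \<and> Es ! m = whole_sub C E \<and>
     sub_obj C N \<in> B01 C C0 C1 \<and>
     quot_obj C (Es ! 0) N \<in> B0 C C0 \<inter> right_orth C (B01 C C0 C1) \<and>
     (\<forall>i \<in> {1..m}. quot_obj C (Es ! i) (Es ! (i - 1)) \<in> right_orth C (B0 C C0) \<and>
        semistable C C0 C1 (quot_obj C (Es ! i) (Es ! (i - 1)))) \<and>
     (\<forall>i \<in> {1..<m}. slope C C0 C1 (quot_obj C (Es ! i) (Es ! (i - 1))) >
        slope C C0 C1 (quot_obj C (Es ! Suc i) (Es ! i))) \<and>
     (E \<notin> B0 C C0 \<longrightarrow> (\<forall>i \<in> {1..m}. \<not> zero_object C (quot_obj C (Es ! i) (Es ! (i - 1))))))"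
    unfolding HN_filtration_def base_def by (simp only: prod.case) blast
  have R: "Sub.HN_chain Es \<and> Sub.null_part N (Es ! 0) \<longleftrightarrow> (\<exists>m. base m \<and> Es ! m = whole_sub C E \<and>
     rank (sub_obj C N) = 0 \<and> deg (sub_obj C N) = 0 \<and> rank (sub_obj C (Es ! 0)) = 0 \<and> Sub.null_free N (Es ! 0) \<and>
     (\<forall>i\<in>{1..m}. Sub.torsion_free (Es ! (i - 1)) (Es ! i) \<and> Sub.interval_semistable (Es ! (i - 1)) (Es ! i)) \<and>
     (\<forall>i\<in>{1..<m}. Sub.interval_slope (Es ! (i - 1)) (Es ! i) > Sub.interval_slope (Es ! i) (Es ! Suc i)) \<and>
     (rank (sub_obj C (whole_sub C E)) \<noteq> 0 \<longrightarrow> (\<forall>i\<in>{1..m}. Es ! (i - 1) \<noteq> Es ! i)))"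
    unfolding Sub.HN_chain_def Sub.null_part_def base_def by blast
  have step: "sub_obj C N \<in> B01 C C0 C1 \<longleftrightarrow> rank (sub_obj C N) = 0 \<and> deg (sub_obj C N) = 0"
    "rank (sub_obj C N) = 0 \<Longrightarrow> quot_obj C (Es ! 0) N \<in> B0 C C0 \<longleftrightarrow> rank (sub_obj C (Es ! 0)) = 0"
    "quot_obj C (Es ! 0) N \<in> right_orth C (B01 C C0 C1) \<longleftrightarrow> Sub.null_free N (Es ! 0)"
    "\<forall>i\<in>{1..m}. (quot_obj C (Es ! i) (Es ! (i - 1)) \<in> right_orth C (B0 C C0)
        \<longleftrightarrow> Sub.torsion_free (Es ! (i - 1)) (Es ! i)) \<and>
      (semistable C C0 C1 (quot_obj C (Es ! i) (Es ! (i - 1))) \<longleftrightarrow> Sub.interval_semistable (Es ! (i - 1)) (Es ! i)) \<and>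
      slope C C0 C1 (quot_obj C (Es ! i) (Es ! (i - 1))) = Sub.interval_slope (Es ! (i - 1)) (Es ! i) \<and>
      (zero_object C (quot_obj C (Es ! i) (Es ! (i - 1))) \<longleftrightarrow> Es ! (i - 1) = Es ! i)"
    if m: "base m" for m
  proof -
    have inS: "Es ! i \<in> Sub C E" if "i \<le> m" for i
      using m that nth_mem[of i Es] unfolding base_def by auto
    have N: "N \<in> Sub C E" "Es ! 0 \<in> Sub C E" "sub_le C N (Es ! 0)"
      using m inS[of 0] unfolding base_def by auto
    have "sub_obj C N \<in> Obj C" using Hom_obj(1)[OF sub_rep(3)[OF N(1)]] .
    then show "sub_obj C N \<in> B01 C C0 C1 \<longleftrightarrow> rank (sub_obj C N) = 0 \<and> deg (sub_obj C N) = 0"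
      by (simp add: B01_eq)
    show "rank (sub_obj C N) = 0 \<Longrightarrow> quot_obj C (Es ! 0) N \<in> B0 C C0 \<longleftrightarrow> rank (sub_obj C (Es ! 0)) = 0"
      using rank_quot[OF N] quot_obj_in[OF N] by (simp add: B0_eq)
    show "quot_obj C (Es ! 0) N \<in> right_orth C (B01 C C0 C1) \<longleftrightarrow> Sub.null_free N (Es ! 0)"
      by (rule B01_orth_quot_iff[OF N])
    show "\<forall>i\<in>{1..m}. (quot_obj C (Es ! i) (Es ! (i - 1)) \<in> right_orth C (B0 C C0)
        \<longleftrightarrow> Sub.torsion_free (Es ! (i - 1)) (Es ! i)) \<and>
      (semistable C C0 C1 (quot_obj C (Es ! i) (Es ! (i - 1))) \<longleftrightarrow> Sub.interval_semistable (Es ! (i - 1)) (Es ! i)) \<and>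
      slope C C0 C1 (quot_obj C (Es ! i) (Es ! (i - 1))) = Sub.interval_slope (Es ! (i - 1)) (Es ! i) \<and>
      (zero_object C (quot_obj C (Es ! i) (Es ! (i - 1))) \<longleftrightarrow> Es ! (i - 1) = Es ! i)"
    proof
      fix i assume i: "i \<in> {1..m}"
      have ST: "Es ! (i - 1) \<in> Sub C E" "Es ! i \<in> Sub C E" "sub_le C (Es ! (i - 1)) (Es ! i)"
        using i inS[of i] inS[of "i - 1"] m unfolding base_def by auto
      show "(quot_obj C (Es ! i) (Es ! (i - 1)) \<in> right_orth C (B0 C C0)
        \<longleftrightarrow> Sub.torsion_free (Es ! (i - 1)) (Es ! i)) \<and>
      (semistable C C0 C1 (quot_obj C (Es ! i) (Es ! (i - 1))) \<longleftrightarrow> Sub.interval_semistable (Es ! (i - 1)) (Es ! i)) \<and>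
      slope C C0 C1 (quot_obj C (Es ! i) (Es ! (i - 1))) = Sub.interval_slope (Es ! (i - 1)) (Es ! i) \<and>
      (zero_object C (quot_obj C (Es ! i) (Es ! (i - 1))) \<longleftrightarrow> Es ! (i - 1) = Es ! i)"
        using B0_orth_quot_iff[OF ST] semistable_quot_iff[OF ST] slope_quot[OF ST] quot_obj_zero_iff[OF ST]
        by simp
    qed
  qed
  have slopes: "(\<forall>i \<in> {1..<m}. slope C C0 C1 (quot_obj C (Es ! i) (Es ! (i - 1))) >
        slope C C0 C1 (quot_obj C (Es ! Suc i) (Es ! i))) \<longleftrightarrow>
     (\<forall>i\<in>{1..<m}. Sub.interval_slope (Es ! (i - 1)) (Es ! i) > Sub.interval_slope (Es ! i) (Es ! Suc i))"
    if "base m" for m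
  proof (rule ball_cong[OF refl])
    fix i assume "i \<in> {1..<m}"
    then have i: "i \<in> {1..m}" "Suc i \<in> {1..m}" by auto
    show "slope C C0 C1 (quot_obj C (Es ! i) (Es ! (i - 1))) > slope C C0 C1 (quot_obj C (Es ! Suc i) (Es ! i))
      \<longleftrightarrow> Sub.interval_slope (Es ! (i - 1)) (Es ! i) > Sub.interval_slope (Es ! i) (Es ! Suc i)"
      using bspec[OF step(4)[OF that] i(1)] bspec[OF step(4)[OF that] i(2)] by simp
  qed
  have EB: "E \<notin> B0 C C0 \<longleftrightarrow> rank (sub_obj C (whole_sub C E)) \<noteq> 0"
    using E_in rank_whole by (simp add: B0_eq)
  have pieces: "(\<forall>i \<in> {1..m}. quot_obj C (Es ! i) (Es ! (i - 1)) \<in> right_orth C (B0 C C0) \<and>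
        semistable C C0 C1 (quot_obj C (Es ! i) (Es ! (i - 1)))) \<longleftrightarrow>
     (\<forall>i\<in>{1..m}. Sub.torsion_free (Es ! (i - 1)) (Es ! i) \<and> Sub.interval_semistable (Es ! (i - 1)) (Es ! i))"
    "(\<forall>i \<in> {1..m}. \<not> zero_object C (quot_obj C (Es ! i) (Es ! (i - 1)))) \<longleftrightarrow> (\<forall>i\<in>{1..m}. Es ! (i - 1) \<noteq> Es ! i)"
    if "base m" for m
    by (rule ball_cong[OF refl]; use step(4)[OF that] in blast)+
  show ?thesis
    unfolding L R EB
  proof (rule ex_cong1, rule conj_cong[OF refl], goal_cases)
    case (1 m)
    then show ?case
      using step(2)[OF 1(1)] by (simp only: Int_iff step(1)[OF 1(1)] step(3)[OF 1(1)] slopes[OF 1(1)] pieces[OF 1(1)]) blast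
  qed
qed

theorem HN_filtration_ex1: "\<exists>!F. HN_filtration C C0 C1 E F"
proof -
  have "HN_filtration C C0 C1 E = (\<lambda>(N, Es). Sub.HN_chain Es \<and> Sub.null_part N (Es ! 0))"
  proof (rule ext)
    fix F show "HN_filtration C C0 C1 E F = (case F of (N, Es) \<Rightarrow> Sub.HN_chain Es \<and> Sub.null_part N (Es ! 0))"
      by (cases F) (simp add: HN_filtration_iff)
  qed
  then show ?thesis using Sub.HN_chain_ex1 by simp
qed

end

theorem proposition3p4:
  fixes A :: "('o, 'm) add_cat"
    and C0 :: "('o \<Rightarrow>\<^sub>0 int) set \<Rightarrow> int"
    and C1 :: "('o \<Rightarrow>\<^sub>0 int) set \<Rightarrow> real"
    and E :: 'o
  assumes "noetherian_abelian_category A"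
    and "slope_like A C0 C1"
    and "E \<in> Obj A"
  shows "\<exists>!F. HN_filtration A C0 C1 E F"
proof -
  interpret slope_category_object A C0 C1 E
    using assms by (simp add: slope_category_object_def slope_category_object_axioms_def)
  show ?thesis by (rule HN_filtration_ex1)
qed

end
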